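(* Let $D$ be a Krull-like PVMD. Then $D[[X]]$ is a Krull-like PVMD if and only if $D$ is a Krull domain.
   Context: For an integral domain $R$ with quotient field $K$: for a nonzero fractional ideal $I$ put $I^{-1}=\{x\in K\mid xI\subseteq R\}$, $I_v=(I^{-1})^{-1}$, and $I_t=\bigcup\{J_v\mid J\subseteq I,\ J \text{ a nonzero finitely generated fractional ideal}\}$. $I$ is a $t$-ideal if $I_t=I$; a maximal $t$-ideal is an ideal maximal among the $t$-ideals properly contained in $R$ (it is a prime ideal). $R$ is a PVMD (Prüfer $v$-multiplication domain) if $(II^{-1})_t=R$ for every nonzero finitely generated ideal $I$ of $R$. A valuation domain $V$ is strongly discrete if $P\ne P^2$ for every nonzero prime ideal $P$ of $V$. $R$ is a Krull-like PVMD if $R$ is a PVMD, $R_M$ is a strongly discrete valuation domain for every maximal $t$-ideal $M$ of $R$, and every principal ideal of $R$ has only finitely many minimal prime ideals. *)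

theory Defs
  imports "HOL-Computational_Algebra.Computational_Algebra"
begin

text \<open>
  Integral domains are represented as subrings \<open>R\<close> of a field type \<open>'k\<close> that is their quotient
  field.  Thus overrings of \<open>R\<close> (localizations, valuation overrings) and fractional ideals of \<open>R\<close>
  are all subsets of \<open>'k\<close>.
\<close>

definition domain_in_field :: "'k::field set \<Rightarrow> bool" where
  "domain_in_field R \<longleftrightarrow>
     1 \<in> R \<and> (\<forall>x\<in>R. \<forall>y\<in>R. x - y \<in> R \<and> x * y \<in> R) \<and>
     (\<forall>x. \<exists>a\<in>R. \<exists>b\<in>R. b \<noteq> 0 \<and> x = a / b)"

text \<open>An abstract integral domain \<open>'a\<close>, viewed inside its field of fractions.\<close>

definition dom_of :: "'a::idom itself \<Rightarrow> 'a fract set" where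
  "dom_of T = range to_fract"

lemma domain_in_field_dom_of: "domain_in_field (dom_of TYPE('a::idom))"
proof -
  have "1 \<in> range (to_fract :: 'a \<Rightarrow> _)"
    using to_fract_1 by (metis rangeI)
  moreover have "x - y \<in> range (to_fract :: 'a \<Rightarrow> _)" "x * y \<in> range (to_fract :: 'a \<Rightarrow> _)"
    if "x \<in> range to_fract" "y \<in> range to_fract" for x y
    using that by (auto simp flip: to_fract_diff to_fract_mult)
  moreover have "\<exists>a\<in>range (to_fract :: 'a \<Rightarrow> _). \<exists>b\<in>range to_fract. b \<noteq> 0 \<and> x = a / b" for x
    by (cases x) (auto simp: Fract_conv_to_fract)
  ultimately show ?thesis
    unfolding domain_in_field_def dom_of_def by blast
qed


subsection \<open>Fractional ideals\<close>

definition submod :: "'k::field set \<Rightarrow> 'k set \<Rightarrow> bool" where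
  "submod R I \<longleftrightarrow> 0 \<in> I \<and> (\<forall>x\<in>I. \<forall>y\<in>I. x + y \<in> I) \<and> (\<forall>r\<in>R. \<forall>x\<in>I. r * x \<in> I)"

definition frac_ideal :: "'k::field set \<Rightarrow> 'k set \<Rightarrow> bool" where
  "frac_ideal R I \<longleftrightarrow> submod R I \<and> (\<exists>d\<in>R. d \<noteq> 0 \<and> (\<forall>x\<in>I. d * x \<in> R))"

definition is_ideal :: "'k::field set \<Rightarrow> 'k set \<Rightarrow> bool" where
  "is_ideal R I \<longleftrightarrow> submod R I \<and> I \<subseteq> R"

definition fin_gen :: "'k::field set \<Rightarrow> 'k set \<Rightarrow> bool" where
  "fin_gen R I \<longleftrightarrow> (\<exists>S. finite S \<and> I = submod R hull S)"

definition ideal_prod :: "'k::field set \<Rightarrow> 'k set \<Rightarrow> 'k set \<Rightarrow> 'k set" where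
  "ideal_prod R I J = submod R hull {x * y | x y. x \<in> I \<and> y \<in> J}"

definition ideal_inv :: "'k::field set \<Rightarrow> 'k set \<Rightarrow> 'k set" where
  "ideal_inv R I = {x. \<forall>y\<in>I. x * y \<in> R}"

definition v_op :: "'k::field set \<Rightarrow> 'k set \<Rightarrow> 'k set" where
  "v_op R I = ideal_inv R (ideal_inv R I)"

definition t_op :: "'k::field set \<Rightarrow> 'k set \<Rightarrow> 'k set" where
  "t_op R I = \<Union> {v_op R J | J. J \<subseteq> I \<and> frac_ideal R J \<and> J \<noteq> {0} \<and> fin_gen R J}"

definition t_ideal :: "'k::field set \<Rightarrow> 'k set \<Rightarrow> bool" where
  "t_ideal R I \<longleftrightarrow> frac_ideal R I \<and> I \<noteq> {0} \<and> t_op R I = I"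

definition maximal_t_ideal :: "'k::field set \<Rightarrow> 'k set \<Rightarrow> bool" where
  "maximal_t_ideal R M \<longleftrightarrow>
     t_ideal R M \<and> M \<subset> R \<and> (\<forall>J. t_ideal R J \<and> J \<subset> R \<and> M \<subseteq> J \<longrightarrow> J = M)"

definition prime_ideal :: "'k::field set \<Rightarrow> 'k set \<Rightarrow> bool" where
  "prime_ideal R P \<longleftrightarrow>
     is_ideal R P \<and> P \<noteq> R \<and> (\<forall>a\<in>R. \<forall>b\<in>R. a * b \<in> P \<longrightarrow> a \<in> P \<or> b \<in> P)"

definition minimal_primes :: "'k::field set \<Rightarrow> 'k set \<Rightarrow> 'k set set" where
  "minimal_primes R I =
     {P. prime_ideal R P \<and> I \<subseteq> P \<and> (\<forall>Q. prime_ideal R Q \<and> I \<subseteq> Q \<and> Q \<subseteq> P \<longrightarrow> Q = P)}"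

definition localization :: "'k::field set \<Rightarrow> 'k set \<Rightarrow> 'k set" where
  "localization R P = {a / s | a s. a \<in> R \<and> s \<in> R \<and> s \<notin> P}"


subsection \<open>Classes of domains\<close>

definition PVMD :: "'k::field set \<Rightarrow> bool" where
  "PVMD R \<longleftrightarrow> domain_in_field R \<and>
     (\<forall>I. is_ideal R I \<and> I \<noteq> {0} \<and> fin_gen R I \<longrightarrow> t_op R (ideal_prod R I (ideal_inv R I)) = R)"

definition valuation_domain :: "'k::field set \<Rightarrow> bool" where
  "valuation_domain V \<longleftrightarrow> domain_in_field V \<and> (\<forall>x. x \<noteq> 0 \<longrightarrow> x \<in> V \<or> inverse x \<in> V)"

definition strongly_discrete_valuation_domain :: "'k::field set \<Rightarrow> bool" where
  "strongly_discrete_valuation_domain V \<longleftrightarrow> valuation_domain V \<and>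
     (\<forall>P. prime_ideal V P \<and> P \<noteq> {0} \<longrightarrow> P \<noteq> ideal_prod V P P)"

definition krull_like_PVMD :: "'k::field set \<Rightarrow> bool" where
  "krull_like_PVMD R \<longleftrightarrow> PVMD R \<and>
     (\<forall>M. maximal_t_ideal R M \<longrightarrow> strongly_discrete_valuation_domain (localization R M)) \<and>
     (\<forall>a\<in>R. finite (minimal_primes R (submod R hull {a})))"

text \<open>
  Rank-one discrete valuations are normalized (surjective onto the integers), so a field is not
  a discrete valuation ring; the value of \<open>v\<close> at \<open>0\<close> is irrelevant.
\<close>

definition discrete_valuation :: "('k::field \<Rightarrow> int) \<Rightarrow> bool" where
  "discrete_valuation v \<longleftrightarrow>
     v ` (UNIV - {0}) = UNIV \<and>
     (\<forall>x y. x \<noteq> 0 \<and> y \<noteq> 0 \<longrightarrow> v (x * y) = v x + v y) \<and>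
     (\<forall>x y. x \<noteq> 0 \<and> y \<noteq> 0 \<and> x + y \<noteq> 0 \<longrightarrow> v (x + y) \<ge> min (v x) (v y))"

definition discrete_valuation_ring :: "'k::field set \<Rightarrow> bool" where
  "discrete_valuation_ring V \<longleftrightarrow>
     (\<exists>v. discrete_valuation v \<and> V = {x. x = 0 \<or> v x \<ge> 0})"

text \<open>
  A Krull domain is the intersection of a family of discrete valuation rings of its quotient field
  such that every nonzero element of the field is a unit in all but finitely many of them.  The
  family may be empty, so fields are Krull domains.
\<close>

definition krull_domain :: "'k::field set \<Rightarrow> bool" where
  "krull_domain R \<longleftrightarrow> domain_in_field R \<and>
     (\<exists>F. (\<forall>V\<in>F. discrete_valuation_ring V) \<and> R = \<Inter>F \<and>
          (\<forall>x. x \<noteq> 0 \<longrightarrow> finite {V \<in> F. \<not> (x \<in> V \<and> inverse x \<in> V)}))"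

end

theory Submission
  imports Defs
begin

text \<open>
  \<^bold>\<open>Necessity.\<close>  Both \<open>D\<close> and \<open>D[[X]]\<close> are intersections of their localizations at maximal
  \<open>t\<close>-ideals, which are valuation domains.  If \<open>c\<close> is almost integral over \<open>D\<close> and
  \<open>a, a\<^sup>2 c \<in> D\<close>, then \<open>z = \<Sum>n. C\<^sub>n a c\<^bsup>n+1\<^esup> X\<^bsup>n+1\<^esup>\<close>, with Catalan numbers \<open>C\<^sub>n\<close>, is a root of
  \<open>z\<^sup>2 - a z + a\<^sup>2 c X\<close> in the quotient field of \<open>D[[X]]\<close>, so \<open>z \<in> D[[X]]\<close> and \<open>a c \<in> D\<close>.  Applied to
  \<open>c\<^sup>2\<close>, this forces \<open>D\<close> to be completely integrally closed; finiteness of minimal primes then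
  excludes nonzero primes strictly below a maximal \<open>t\<close>-ideal, so the localizations are discrete
  valuation rings, and they have finite character.

  \<^bold>\<open>Sufficiency.\<close>  For a valuation ring \<open>V\<close> of an integer-valued valuation \<open>v\<close>, the ring \<open>V((X))\<close>
  is Euclidean with respect to \<open>v\<close> of the lowest coefficient.  Its prime elements, for all \<open>V\<close> in a
  defining family of \<open>D\<close>, together with the \<open>X\<close>-order define \<open>D[[X]]\<close> as a Krull domain, and Krull
  domains are Krull-like PVMDs.
\<close>

subsection \<open>The \<open>t\<close>-operation and maximal \<open>t\<close>-ideals\<close>

text \<open>Let K be the quotient field of D. The quotient field of D[[X]] need not be all of
  K((X)), and this shapes both directions. In the necessity proof the series z always lies in K[[X]]
  and satisfies a monic equation over D[[X]], but integral closedness of D[[X]] says nothing about z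
  until z is known to be a quotient of elements of D[[X]]. Almost integrality of c provides exactly
  that: one constant q clears the denominators of all coefficients. The series is the expansion of a
  (1 - sqrt(1 - 4cX)) / 2, rewritten with integer coefficients so that nothing is divided by 2 and
  every characteristic is covered. In the sufficiency proof the valuations are built on K((X)),
  where division with remainder works without any bound on denominators, and only then restricted to
  the quotient field of D[[X]].\<close>

lemma submod_hull: "submod R (submod R hull S)"
  by (rule hull_in) (auto simp: submod_def)

lemma hull_subset_submod: "S \<subseteq> I \<Longrightarrow> submod R I \<Longrightarrow> submod R hull S \<subseteq> I"
  by (rule hull_minimal)

lemma submod_zero: "submod R I \<Longrightarrow> 0 \<in> I"
  and submod_add: "submod R I \<Longrightarrow> x \<in> I \<Longrightarrow> y \<in> I \<Longrightarrow> x + y \<in> I"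
  and submod_mult: "submod R I \<Longrightarrow> r \<in> R \<Longrightarrow> x \<in> I \<Longrightarrow> r * x \<in> I"
  by (auto simp: submod_def)

lemma ideal_inv_antimono: "A \<subseteq> B \<Longrightarrow> ideal_inv R B \<subseteq> ideal_inv R A"
  by (auto simp: ideal_inv_def)

lemma v_op_mono: "A \<subseteq> B \<Longrightarrow> v_op R A \<subseteq> v_op R B"
  unfolding v_op_def by (intro ideal_inv_antimono)

lemma subset_v_op: "A \<subseteq> v_op R A"
  by (auto simp: v_op_def ideal_inv_def mult.commute)

lemma ideal_inv_v_op: "ideal_inv R (v_op R A) = ideal_inv R A"
proof
  show "ideal_inv R (v_op R A) \<subseteq> ideal_inv R A"
    by (intro ideal_inv_antimono subset_v_op)
  show "ideal_inv R A \<subseteq> ideal_inv R (v_op R A)"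
    using subset_v_op[of "ideal_inv R A" R] by (simp add: v_op_def)
qed

lemma v_op_ideal_inv: "v_op R (ideal_inv R A) = ideal_inv R A"
  using ideal_inv_v_op[of R A] by (simp add: v_op_def)

locale fraction_domain =
  fixes R :: "'k::field set"
  assumes dom: "domain_in_field R"
begin

lemma one [simp]: "1 \<in> R" and diff: "x \<in> R \<Longrightarrow> y \<in> R \<Longrightarrow> x - y \<in> R"
  and mult [intro]: "x \<in> R \<Longrightarrow> y \<in> R \<Longrightarrow> x * y \<in> R"
  using dom by (auto simp: domain_in_field_def)

lemma zero [simp]: "0 \<in> R"
  using diff[of 1 1] by simp

lemma add: "x \<in> R \<Longrightarrow> y \<in> R \<Longrightarrow> x + y \<in> R"
  using diff[of x "0 - y"] diff[of 0 y] by simp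

lemma power [intro]: "x \<in> R \<Longrightarrow> x ^ n \<in> R"
  by (induction n) auto

lemma quotient_rep:
  obtains a b where "a \<in> R" "b \<in> R" "b \<noteq> 0" "x = a / b"
  using dom unfolding domain_in_field_def by blast

lemma submod_self: "submod R R"
  by (auto simp: submod_def add)

lemma submod_ideal_inv: "submod R (ideal_inv R A)"
  using add by (auto simp: submod_def ideal_inv_def distrib_right mult.assoc)

lemma ideal_inv_hull: "ideal_inv R (submod R hull S) = ideal_inv R S"
proof
  show "ideal_inv R (submod R hull S) \<subseteq> ideal_inv R S"
    by (intro ideal_inv_antimono hull_subset)
  show "ideal_inv R S \<subseteq> ideal_inv R (submod R hull S)"
  proof
    fix x assume x: "x \<in> ideal_inv R S"
    have "submod R {y. x * y \<in> R}"
      using add by (auto simp: submod_def distrib_left mult.left_commute)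
    moreover have "S \<subseteq> {y. x * y \<in> R}"
      using x by (auto simp: ideal_inv_def)
    ultimately have "submod R hull S \<subseteq> {y. x * y \<in> R}"
      by (intro hull_subset_submod)
    then show "x \<in> ideal_inv R (submod R hull S)"
      by (auto simp: ideal_inv_def)
  qed
qed

lemma ideal_inv_self: "ideal_inv R R = R"
  by (auto simp: ideal_inv_def dest: bspec[of _ _ 1])

lemma v_op_self: "v_op R R = R"
  by (simp add: v_op_def ideal_inv_self)

lemma is_ideal_one: "is_ideal R I \<Longrightarrow> 1 \<in> I \<Longrightarrow> I = R"
  using submod_mult[of R I _ 1] by (auto simp: is_ideal_def)

lemma prime_idealD:
  assumes "prime_ideal R P"
  shows "submod R P" "P \<subseteq> R" "1 \<notin> P" "0 \<in> P"
    "\<And>a b. a \<in> R \<Longrightarrow> b \<in> R \<Longrightarrow> a * b \<in> P \<Longrightarrow> a \<in> P \<or> b \<in> P"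
    "\<And>a b. a \<in> R \<Longrightarrow> b \<in> P \<Longrightarrow> a * b \<in> P"
    "\<And>a b. a \<in> R \<Longrightarrow> b \<in> P \<Longrightarrow> b * a \<in> P"
  using assms is_ideal_one
  by (auto simp: prime_ideal_def is_ideal_def submod_def mult.commute)

lemma prime_power: "prime_ideal R P \<Longrightarrow> x \<in> R \<Longrightarrow> x \<notin> P \<Longrightarrow> x ^ n \<notin> P"
proof (induction n)
  case (Suc n)
  then show ?case using prime_idealD(5)[of P x "x ^ n"] by auto
qed (simp add: prime_idealD(3))

lemma prime_hull_iff: "prime_ideal R P \<Longrightarrow> submod R hull {a} \<subseteq> P \<longleftrightarrow> a \<in> P"
  using hull_subset_submod[of "{a}" P R] hull_subset[of "{a}" "submod R"]
  by (auto dest: prime_idealD(1))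

lemma minimal_primes_hull_iff:
  "P \<in> minimal_primes R (submod R hull {a}) \<longleftrightarrow>
     prime_ideal R P \<and> a \<in> P \<and> (\<forall>Q. prime_ideal R Q \<and> a \<in> Q \<and> Q \<subseteq> P \<longrightarrow> Q = P)"
  using prime_hull_iff unfolding minimal_primes_def by blast

lemma v_op_subset_t_op:
  assumes "finite S" "S \<subseteq> I" "frac_ideal R I" "s \<in> S" "s \<noteq> 0"
  shows "v_op R S \<subseteq> t_op R I"
proof -
  let ?J = "submod R hull S"
  have sub: "?J \<subseteq> I"
    using assms by (intro hull_subset_submod) (auto simp: frac_ideal_def)
  moreover have "frac_ideal R ?J"
    using assms(3) sub submod_hull[of R S] unfolding frac_ideal_def by blast
  moreover have "?J \<noteq> {0}"
    using assms hull_subset[of S "submod R"] by auto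
  moreover have "fin_gen R ?J"
    using assms by (auto simp: fin_gen_def)
  moreover have "v_op R S = v_op R ?J"
    by (simp add: v_op_def ideal_inv_hull)
  ultimately show ?thesis
    unfolding t_op_def by blast
qed

lemma subset_t_op:
  assumes "frac_ideal R I" "I \<noteq> {0}"
  shows "I \<subseteq> t_op R I"
proof
  fix x assume x: "x \<in> I"
  have "0 \<in> I" using assms by (auto simp: frac_ideal_def submod_def)
  \<comment> \<open>The extra nonzero generator keeps the ideal generated by \<open>{x, y}\<close>
    nonzero even for \<open>x = 0\<close>, as \<open>t_op\<close> demands.\<close>
  then obtain y where y: "y \<in> I" "y \<noteq> 0" using assms by auto
  show "x \<in> t_op R I"
    using v_op_subset_t_op[of "{x, y}" I y] subset_v_op[of "{x, y}" R] assms x y by auto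
qed

lemma t_op_subset_v_op: "t_op R I \<subseteq> v_op R I"
  using v_op_mono[of _ I R] by (auto simp: t_op_def)

lemma frac_ideal_integral: "submod R I \<Longrightarrow> I \<subseteq> R \<Longrightarrow> frac_ideal R I"
  unfolding frac_ideal_def by (auto intro!: bexI[of _ 1])

text \<open>Every inverse is fixed by \<open>v_op\<close>, and \<open>t_op\<close> lies between the
  identity and \<open>v_op\<close>. Conductors and colon ideals are recognized as
  \<open>t\<close>-ideals below by writing them as inverses.\<close>

lemma t_ideal_ideal_inv:
  assumes "ideal_inv R A \<subseteq> R" "ideal_inv R A \<noteq> {0}"
  shows "t_ideal R (ideal_inv R A)"
proof -
  have "frac_ideal R (ideal_inv R A)"
    using assms submod_ideal_inv by (intro frac_ideal_integral) auto
  then show ?thesis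
    using assms subset_t_op t_op_subset_v_op[of "ideal_inv R A"]
    by (auto simp: t_ideal_def v_op_ideal_inv)
qed

lemma t_ideal_proper_iff: "t_ideal R I \<Longrightarrow> I \<subseteq> R \<Longrightarrow> I \<noteq> R \<longleftrightarrow> 1 \<notin> I"
  using is_ideal_one[of I] one unfolding t_ideal_def frac_ideal_def is_ideal_def by blast

text \<open>The \<open>t\<close>-operation has finite character: a finitely generated
  \<open>J\<close> inside the union of a chain already lies in one member, which is closed under
  \<open>t_op\<close>. Properness survives because it amounts to omitting \<open>1\<close>.\<close>

lemma t_ideal_Union:
  assumes "C \<noteq> {}" "subset.chain {I. t_ideal R I \<and> I \<subset> R} C"
  shows "t_ideal R (\<Union>C) \<and> \<Union>C \<subset> R"
proof -
  have C: "t_ideal R I" "I \<subseteq> R" "I \<noteq> R" "1 \<notin> I" if "I \<in> C" for I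
    using assms that t_ideal_proper_iff[of I] by (auto simp: subset.chain_def)
  have lin: "I \<subseteq> J \<or> J \<subseteq> I" if "I \<in> C" "J \<in> C" for I J
    using assms that by (auto simp: subset.chain_def)
  have sub: "submod R I" if "I \<in> C" for I
    using C[OF that] by (auto simp: t_ideal_def frac_ideal_def)
  have "submod R (\<Union>C)"
    unfolding submod_def
  proof (intro conjI ballI)
    show "0 \<in> \<Union>C" using assms(1) sub by (auto simp: submod_def)
    show "r * x \<in> \<Union>C" if "r \<in> R" "x \<in> \<Union>C" for r x
      using that sub submod_mult by blast
    fix x y assume "x \<in> \<Union>C" "y \<in> \<Union>C"
    then obtain I where "I \<in> C" "x \<in> I" "y \<in> I"
      using lin by blast
    then show "x + y \<in> \<Union>C" using sub submod_add by blast
  qed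
  moreover have UR: "\<Union>C \<subseteq> R" using C by auto
  ultimately have frac: "frac_ideal R (\<Union>C)" by (rule frac_ideal_integral)
  obtain I where I: "I \<in> C" using assms(1) by auto
  have "0 \<in> I" "I \<noteq> {0}" using sub[OF I] C[OF I] by (auto simp: submod_def t_ideal_def)
  then have ne: "\<Union>C \<noteq> {0}" using I by blast
  have "t_op R (\<Union>C) \<subseteq> \<Union>C"
  proof
    fix x assume "x \<in> t_op R (\<Union>C)"
    then obtain J where J: "J \<subseteq> \<Union>C" "frac_ideal R J" "J \<noteq> {0}" "fin_gen R J" "x \<in> v_op R J"
      by (auto simp: t_op_def)
    then obtain S where S: "finite S" "J = submod R hull S" by (auto simp: fin_gen_def)
    have "S \<subseteq> \<Union>C" using S J hull_subset[of S "submod R"] by auto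
    then obtain I where I: "I \<in> C" "S \<subseteq> I"
      using finite_subset_Union_chain[OF S(1) _ assms(1), of "{I. t_ideal R I \<and> I \<subset> R}"] assms(2)
      by metis
    then have "J \<subseteq> I" using S sub hull_subset_submod by metis
    then have "x \<in> t_op R I" using J by (auto simp: t_op_def)
    then show "x \<in> \<Union>C" using C[OF I(1)] I by (auto simp: t_ideal_def)
  qed
  then have "t_ideal R (\<Union>C)"
    using frac ne subset_t_op by (auto simp: t_ideal_def)
  moreover have "1 \<notin> \<Union>C" using C by auto
  ultimately show ?thesis using UR by auto
qed

lemma ex_maximal_t_ideal:
  assumes "t_ideal R I" "I \<subset> R"
  obtains M where "maximal_t_ideal R M" "I \<subseteq> M"
proof -
  let ?A = "{J. t_ideal R J \<and> J \<subset> R \<and> I \<subseteq> J}"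
  have "\<exists>M\<in>?A. \<forall>X\<in>?A. M \<subseteq> X \<longrightarrow> X = M"
  proof (rule subset_Zorn_nonempty)
    show "?A \<noteq> {}" using assms by auto
    fix C assume C: "C \<noteq> {}" "subset.chain ?A C"
    then have "subset.chain {I. t_ideal R I \<and> I \<subset> R} C"
      by (auto simp: subset.chain_def)
    moreover have "I \<subseteq> \<Union>C"
      using C by (fastforce simp: subset.chain_def)
    ultimately show "\<Union>C \<in> ?A"
      using t_ideal_Union[OF C(1)] by simp
  qed
  then obtain M where M: "M \<in> ?A" "\<forall>X\<in>?A. M \<subseteq> X \<longrightarrow> X = M" by blast
  then have "maximal_t_ideal R M"
    unfolding maximal_t_ideal_def by blast
  then show ?thesis using M that by auto
qed

section \<open>A domain as the intersection of its localizations at maximal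
  \<open>t\<close>-ideals\<close>

lemma conductor_eq: "ideal_inv R {1, x} = {a \<in> R. a * x \<in> R}"
  by (auto simp: ideal_inv_def)

text \<open>The conductor of \<open>x\<close> is an inverse, hence a proper \<open>t\<close>-ideal,
  and lies in some maximal \<open>t\<close>-ideal \<open>M\<close>. Any denominator of
  \<open>x\<close> belongs to the conductor, so none is available outside \<open>M\<close>.\<close>

lemma ex_localization_excluding:
  assumes "x \<notin> R"
  obtains M where "maximal_t_ideal R M" "x \<notin> localization R M"
proof -
  let ?I = "ideal_inv R {1, x}"
  obtain a b where "a \<in> R" "b \<in> R" "b \<noteq> 0" "x = a / b" by (rule quotient_rep)
  then have "b \<in> ?I" "b \<noteq> 0" by (auto simp: conductor_eq)
  then have "?I \<noteq> {0}" by blast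
  moreover have "1 \<notin> ?I" using assms by (auto simp: conductor_eq)
  ultimately have "t_ideal R ?I" "?I \<subset> R"
    using t_ideal_ideal_inv[of "{1, x}"] one unfolding conductor_eq by blast+
  then obtain M where M: "maximal_t_ideal R M" "?I \<subseteq> M" by (rule ex_maximal_t_ideal)
  moreover have "x \<notin> localization R M"
  proof
    assume "x \<in> localization R M"
    then obtain a s where as: "a \<in> R" "s \<in> R" "s \<notin> M" "x = a / s"
      by (auto simp: localization_def)
    then have "s \<in> ?I" by (cases "s = 0") (auto simp: conductor_eq)
    with as M show False by auto
  qed
  ultimately show ?thesis using that by blast
qed

lemma maximal_t_idealD:
  assumes "maximal_t_ideal R M"
  shows "submod R M" "M \<subseteq> R" "1 \<notin> M" "0 \<in> M" "M \<noteq> {0}" "t_op R M = M" "frac_ideal R M"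
  using assms t_ideal_proper_iff[of M]
  by (auto simp: maximal_t_ideal_def t_ideal_def frac_ideal_def submod_def)

lemma mem_localizationI: "a \<in> R \<Longrightarrow> s \<in> R \<Longrightarrow> s \<notin> M \<Longrightarrow> a / s \<in> localization R M"
  by (auto simp: localization_def)

lemma mem_localization: "1 \<notin> M \<Longrightarrow> a \<in> R \<Longrightarrow> a \<in> localization R M"
  using mem_localizationI[of a 1] by simp

lemma localization_cases:
  assumes "x \<in> localization R M" "0 \<in> M"
  obtains a s where "a \<in> R" "s \<in> R" "s \<notin> M" "s \<noteq> 0" "x = a / s"
  using assms by (auto simp: localization_def)

lemma inverse_notin_localization:
  assumes "submod R M" "r \<in> M" "r \<noteq> 0"
  shows "inverse r \<notin> localization R M"
proof
  assume "inverse r \<in> localization R M"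
  then obtain a s where as: "a \<in> R" "s \<notin> M" "s \<noteq> 0" "inverse r = a / s"
    using assms submod_zero[of R M] by (auto elim: localization_cases)
  then have "s = a * r" using assms(3) by (simp add: field_simps)
  then show False using as assms submod_mult by blast
qed

end

subsection \<open>Integer-valued valuations\<close>

definition int_valuation :: "('k::field \<Rightarrow> int) \<Rightarrow> bool" where
  "int_valuation v \<longleftrightarrow>
     (\<forall>x y. x \<noteq> 0 \<and> y \<noteq> 0 \<longrightarrow> v (x * y) = v x + v y) \<and>
     (\<forall>x y. x \<noteq> 0 \<and> y \<noteq> 0 \<and> x + y \<noteq> 0 \<longrightarrow> v (x + y) \<ge> min (v x) (v y))"

lemma discrete_valuation_int_valuation: "discrete_valuation v \<Longrightarrow> int_valuation v"
  by (auto simp: discrete_valuation_def int_valuation_def)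

context
  fixes v :: "'k::field \<Rightarrow> int"
  assumes v: "int_valuation v"
begin

lemma int_valuation_mult: "x \<noteq> 0 \<Longrightarrow> y \<noteq> 0 \<Longrightarrow> v (x * y) = v x + v y"
  and int_valuation_add: "x \<noteq> 0 \<Longrightarrow> y \<noteq> 0 \<Longrightarrow> x + y \<noteq> 0 \<Longrightarrow> v (x + y) \<ge> min (v x) (v y)"
  using v by (auto simp: int_valuation_def)

lemma int_valuation_one: "v 1 = 0"
  using int_valuation_mult[of 1 1] by simp

lemma int_valuation_minus: "v (- x) = v x"
proof (cases "x = 0")
  case False
  have "v (- 1) = 0"
    using int_valuation_mult[of "- 1" "- 1"] int_valuation_one by simp
  then show ?thesis
    using int_valuation_mult[of "- 1" x] False by simp
qed simp

lemma int_valuation_inverse: "x \<noteq> 0 \<Longrightarrow> v (inverse x) = - v x"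
  using int_valuation_mult[of x "inverse x"] int_valuation_one by simp

lemma int_valuation_divide: "x \<noteq> 0 \<Longrightarrow> y \<noteq> 0 \<Longrightarrow> v (x / y) = v x - v y"
  by (simp add: divide_inverse int_valuation_mult int_valuation_inverse)

lemma int_valuation_power: "x \<noteq> 0 \<Longrightarrow> v (x ^ n) = int n * v x"
  by (induction n) (simp_all add: int_valuation_one int_valuation_mult distrib_right)

lemma int_valuation_add_ge:
  assumes "x = 0 \<or> k \<le> v x" "y = 0 \<or> k \<le> v y"
  shows "x + y = 0 \<or> k \<le> v (x + y)"
  using assms int_valuation_add[of x y] by (cases "x = 0"; cases "y = 0"; cases "x + y = 0") auto

lemma int_valuation_diff_ge:
  assumes "x = 0 \<or> k \<le> v x" "y = 0 \<or> k \<le> v y"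
  shows "x - y = 0 \<or> k \<le> v (x - y)"
  using int_valuation_add_ge[of x k "- y"] assms by (simp add: int_valuation_minus)

lemma int_valuation_mult_ge:
  assumes "x = 0 \<or> k \<le> v x" "y = 0 \<or> l \<le> v y"
  shows "x * y = 0 \<or> k + l \<le> v (x * y)"
  using assms by (cases "x = 0"; cases "y = 0") (auto simp: int_valuation_mult)

lemma int_valuation_prod:
  "finite A \<Longrightarrow> (\<And>i. i \<in> A \<Longrightarrow> f i \<noteq> 0) \<Longrightarrow> v (prod f A) = (\<Sum>i\<in>A. v (f i))"
  by (induction A rule: finite_induct) (auto simp: int_valuation_one int_valuation_mult)

end

text \<open>An element \<open>x\<close> of least value in a nonzero prime \<open>P\<close> has
  positive value, so products of two elements of \<open>P\<close> have value greater than
  \<open>v x\<close> and cannot generate \<open>x\<close>.\<close>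

lemma discrete_valuation_ring_strongly_discrete:
  assumes "discrete_valuation_ring V"
  shows "strongly_discrete_valuation_domain V"
proof -
  obtain v where v: "discrete_valuation v" and V: "V = {x. x = 0 \<or> v x \<ge> 0}"
    using assms by (auto simp: discrete_valuation_ring_def)
  have iv: "int_valuation v" using v by (rule discrete_valuation_int_valuation)
  have val: "x \<in> V \<or> inverse x \<in> V" for x
    using int_valuation_inverse[OF iv, of x] by (auto simp: V)
  have dom: "domain_in_field V"
    unfolding domain_in_field_def
  proof (intro conjI ballI allI)
    show "1 \<in> V" using int_valuation_one[OF iv] by (simp add: V)
    show "x - y \<in> V" if "x \<in> V" "y \<in> V" for x y
      using int_valuation_diff_ge[OF iv, of x 0 y] that by (simp add: V)
    show "x * y \<in> V" if "x \<in> V" "y \<in> V" for x y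
      using int_valuation_mult_ge[OF iv, of x 0 y 0] that by (simp add: V)
    show "\<exists>a\<in>V. \<exists>b\<in>V. b \<noteq> 0 \<and> x = a / b" for x
    proof (cases "x \<in> V")
      case True
      then show ?thesis using \<open>1 \<in> V\<close> by (intro bexI[of _ x] bexI[of _ 1]) auto
    next
      case False
      then have "x \<noteq> 0" "inverse x \<in> V" using val by (auto simp: V)
      then show ?thesis
        using \<open>1 \<in> V\<close> by (intro bexI[of _ 1] bexI[of _ "inverse x"]) (auto simp: divide_inverse)
    qed
  qed
  interpret fraction_domain V by standard (rule dom)
  have "P \<noteq> ideal_prod V P P" if P: "prime_ideal V P" "P \<noteq> {0}" for P
  proof
    assume eq: "P = ideal_prod V P P"
    note P' = prime_idealD[OF P(1)]
    obtain y where y: "y \<in> P" "y \<noteq> 0" using P(2) P'(4) by blast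
    obtain x where x: "x \<in> P" "x \<noteq> 0" "\<And>z. z \<in> P \<Longrightarrow> z \<noteq> 0 \<Longrightarrow> nat (v x) \<le> nat (v z)"
      using ex_has_least_nat[of "\<lambda>x. x \<in> P \<and> x \<noteq> 0" y "\<lambda>x. nat (v x)"] y by blast
    have ge: "v x \<le> v z" if "z \<in> P" "z \<noteq> 0" for z
      using x(3)[OF that] P'(2) x(1,2) that by (auto simp: V)
    have "v x \<noteq> 0"
    proof
      assume "v x = 0"
      then have "inverse x \<in> V" using int_valuation_inverse[OF iv x(2)] by (simp add: V)
      then show False using P'(3) P'(6)[of "inverse x" x] x by simp
    qed
    moreover have "v x \<ge> 0" using x P'(2) by (auto simp: V)
    ultimately have pos: "v x > 0" by simp
    let ?I = "{y. y = 0 \<or> v x + 1 \<le> v y}"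
    have "submod V ?I"
      unfolding submod_def
      using int_valuation_add_ge[OF iv, of _ "v x + 1"] int_valuation_mult_ge[OF iv, of _ 0 _ "v x + 1"]
      by (auto simp: V)
    moreover have "y * z \<in> ?I" if "y \<in> P" "z \<in> P" for y z
      using ge[OF that(1)] ge[OF that(2)] pos int_valuation_mult[OF iv, of y z]
      by (cases "y = 0"; cases "z = 0") auto
    then have "{x * y |x y. x \<in> P \<and> y \<in> P} \<subseteq> ?I" by blast
    ultimately have "ideal_prod V P P \<subseteq> ?I"
      unfolding ideal_prod_def by (rule hull_subset_submod[rotated])
    then have "x \<in> ?I" using eq x(1) by blast
    then show False using x(2) by simp
  qed
  then show ?thesis
    using dom val by (auto simp: strongly_discrete_valuation_domain_def valuation_domain_def)
qed

text \<open>The valuation is the exponent \<open>k\<close> in \<open>rep\<close>, unique because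
  \<open>p\<close> is not a unit. That \<open>V\<close> is a valuation ring comes out as a result,
  so the criterion serves localizations in which only a uniformizer has been found.\<close>

lemma discrete_valuation_ringI:
  fixes V :: "'k::field set"
  assumes one: "1 \<in> V" and diff: "\<And>x y. x \<in> V \<Longrightarrow> y \<in> V \<Longrightarrow> x - y \<in> V"
    and mult: "\<And>x y. x \<in> V \<Longrightarrow> y \<in> V \<Longrightarrow> x * y \<in> V"
    and p: "p \<in> V" "inverse p \<notin> V"
    and rep: "\<And>x. x \<noteq> 0 \<Longrightarrow> \<exists>k::int. x / p powi k \<in> V \<and> inverse (x / p powi k) \<in> V"
  shows "discrete_valuation_ring V"
proof -
  have zero: "0 \<in> V" using diff[OF one one] by simp
  have add: "x + y \<in> V" if "x \<in> V" "y \<in> V" for x y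
    using diff[OF that(1) diff[OF zero that(2)]] by simp
  have p0: "p \<noteq> 0" using p zero by auto
  define U where "U = {u. u \<noteq> 0 \<and> u \<in> V \<and> inverse u \<in> V}"
  have power: "p ^ n \<in> V" for n by (induction n) (auto simp: one mult p)
  have U_div: "u / w \<in> U" if "u \<in> U" "w \<in> U" for u w
    using that mult by (auto simp: U_def divide_inverse)
  have U_mult: "u * w \<in> U" if "u \<in> U" "w \<in> U" for u w
    using that mult by (auto simp: U_def)
  have no_pos: "p ^ Suc n * w \<notin> U" if "w \<in> V" for n w
  proof
    assume u: "p ^ Suc n * w \<in> U"
    then have "p ^ n * w * inverse (p ^ Suc n * w) \<in> V"
      using mult power that by (auto simp: U_def)
    moreover have "p ^ n * w * inverse (p ^ Suc n * w) = inverse p"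
      using u p0 by (simp add: U_def field_simps)
    ultimately have "inverse p \<in> V" by (simp only:)
    then show False using p by simp
  qed
  have powi_unit: "k = 0" if "p powi k \<in> U" for k
  proof (rule ccontr)
    assume "k \<noteq> 0"
    then obtain n where "k = int (Suc n) \<or> k = - int (Suc n)"
      by (metis not0_implies_Suc int_cases2 of_nat_0 neg_equal_0_iff_equal)
    then show False
    proof
      assume "k = int (Suc n)"
      then have "p powi k = p ^ Suc n" by (simp only: power_int_of_nat)
      then show False using no_pos[OF one, of n] that by simp
    next
      assume "k = - int (Suc n)"
      then have "p powi k = inverse (p ^ Suc n)" by (simp only: power_int_minus power_int_of_nat)
      then have "p ^ Suc n \<in> U" using that p0 by (auto simp: U_def)
      then show False using no_pos[OF one, of n] by simp
    qed
  qed
  define v where "v x = (SOME k. x / p powi k \<in> U)" for x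
  have v: "x / p powi v x \<in> U" if "x \<noteq> 0" for x
    unfolding v_def by (rule someI_ex) (use rep[OF that] that p0 in \<open>auto simp: U_def\<close>)
  have v_eq: "v x = k" if "x \<noteq> 0" "x / p powi k \<in> U" for x k
  proof -
    have "(x / p powi k) / (x / p powi v x) = p powi (v x - k)"
      using that(1) p0 by (simp add: power_int_diff)
    then have "p powi (v x - k) \<in> U" using U_div[OF that(2) v[OF that(1)]] by (simp only:)
    then have "v x - k = 0" by (rule powi_unit)
    then show ?thesis by simp
  qed
  have v_mult: "v (x * y) = v x + v y" if "x \<noteq> 0" "y \<noteq> 0" for x y
    using U_mult[OF v[OF that(1)] v[OF that(2)]] that p0
    by (intro v_eq) (auto simp: power_int_add)
  have V_iff: "x \<in> V \<longleftrightarrow> v x \<ge> 0" if "x \<noteq> 0" for x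
  proof
    assume "v x \<ge> 0"
    then have "p powi v x = p ^ nat (v x)" by (simp add: power_int_def)
    then have "x = p ^ nat (v x) * (x / p powi v x)" using p0 by simp
    then show "x \<in> V" using mult power v[OF that] unfolding U_def by (metis (lifting) mem_Collect_eq)
  next
    assume x: "x \<in> V"
    show "v x \<ge> 0"
    proof (rule ccontr)
      assume "\<not> v x \<ge> 0"
      then obtain n where "v x = - int (Suc n)"
        by (metis int_cases2 negD not_le of_nat_0_le_iff)
      then have "p powi v x = inverse (p ^ Suc n)" by (simp only: power_int_minus power_int_of_nat)
      then have "p ^ Suc n * x \<in> U" using v[OF that] by (simp add: field_simps)
      then show False using no_pos x by blast
    qed
  qed
  have v_le: "v (x + y) \<ge> v x" if "x \<noteq> 0" "y \<noteq> 0" "x + y \<noteq> 0" "v x \<le> v y" for x y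
  proof -
    \<comment> \<open>Dividing by the summand of smaller value reduces the inequality to
      \<open>1 + y / x \<in> V\<close>.\<close>
    have "v y = v x + v (y / x)" using v_mult[of x "y / x"] that by simp
    then have "y / x \<in> V" using V_iff[of "y / x"] that by simp
    then have "(x + y) / x \<in> V" using add[OF one] that by (simp add: add_divide_distrib)
    then have "v ((x + y) / x) \<ge> 0" using V_iff[of "(x + y) / x"] that by simp
    moreover have "v (x + y) = v x + v ((x + y) / x)" using v_mult[of x "(x + y) / x"] that by simp
    ultimately show ?thesis by simp
  qed
  have "discrete_valuation v"
    unfolding discrete_valuation_def
  proof (intro conjI allI impI)
    show "v ` (UNIV - {0}) = UNIV"
    proof -
      have "k \<in> v ` (UNIV - {0})" for k
      proof
        show "k = v (p powi k)" using p0 one by (intro v_eq[symmetric]) (auto simp: U_def)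
      qed (use p0 in auto)
      then show ?thesis by blast
    qed
    show "v (x * y) = v x + v y" if "x \<noteq> 0 \<and> y \<noteq> 0" for x y
      using v_mult that by blast
    show "min (v x) (v y) \<le> v (x + y)" if "x \<noteq> 0 \<and> y \<noteq> 0 \<and> x + y \<noteq> 0" for x y
      using v_le[of x y] v_le[of y x] that by (cases "v x \<le> v y") (auto simp: add.commute)
  qed
  moreover have "x \<in> V \<longleftrightarrow> x = 0 \<or> v x \<ge> 0" for x
    using V_iff[of x] zero by (cases "x = 0") auto
  then have "V = {x. x = 0 \<or> v x \<ge> 0}" by blast
  ultimately show ?thesis unfolding discrete_valuation_ring_def by blast
qed

subsection \<open>Completely integrally closed Krull-like PVMDs\<close>

definition completely_integrally_closed :: "'k::field set \<Rightarrow> bool" where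
  "completely_integrally_closed R \<longleftrightarrow>
     (\<forall>c q. q \<noteq> 0 \<and> (\<forall>n. q * c ^ n \<in> R) \<longrightarrow> c \<in> R)"

context fraction_domain
begin

text \<open>The set \<open>localization R M\<close> makes sense before \<open>M\<close> is known to
  be prime. If it is closed under multiplication, then inverses of elements outside \<open>M\<close>
  multiply, whereas nonzero elements of \<open>M\<close> never become invertible.\<close>

lemma maximal_t_ideal_prime:
  assumes M: "maximal_t_ideal R M" and V: "domain_in_field (localization R M)"
  shows "prime_ideal R M"
proof -
  interpret V: fraction_domain "localization R M" by standard (rule V)
  note M' = maximal_t_idealD[OF M]
  have "a \<in> M \<or> b \<in> M" if "a \<in> R" "b \<in> R" "a * b \<in> M" for a b
  proof (rule ccontr)
    assume "\<not> ?thesis"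
    then have ab: "a \<notin> M" "b \<notin> M" "a \<noteq> 0" "b \<noteq> 0" using M'(4) by auto
    then have "inverse a * inverse b \<in> localization R M"
      using mem_localizationI[of 1 a M] mem_localizationI[of 1 b M] that
      by (intro V.mult) (auto simp: divide_inverse)
    then have "inverse (a * b) \<in> localization R M" by simp
    moreover have "inverse (a * b) \<notin> localization R M"
      using M'(1) that(3) ab by (intro inverse_notin_localization) auto
    ultimately show False by simp
  qed
  then show ?thesis
    using M'(1-3) one unfolding prime_ideal_def is_ideal_def by blast
qed

text \<open>Otherwise \<open>y / x = a / s\<close> with \<open>s\<close> outside \<open>N\<close>,
  and \<open>y * s = a * x\<close> contradicts primality of \<open>P\<close>. Applied to powers of
  \<open>y\<close>, which also avoid \<open>P\<close>, this makes \<open>x\<close> divisible by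
  arbitrarily high powers of \<open>y\<close> locally at \<open>N\<close>.\<close>

lemma quotient_mem_localization:
  assumes V: "valuation_domain (localization R N)"
    and N: "0 \<in> N" and P: "prime_ideal R P" "P \<subseteq> N" and x: "x \<in> P" and y: "y \<in> R" "y \<notin> P"
  shows "x / y \<in> localization R N"
proof (rule ccontr)
  note P' = prime_idealD[OF P(1)]
  assume not: "x / y \<notin> localization R N"
  have "y \<noteq> 0" using y P'(4) by auto
  have "x \<noteq> 0" using not V by (auto simp: valuation_domain_def fraction_domain.zero fraction_domain_def)
  then have "y / x \<in> localization R N"
    using not V \<open>y \<noteq> 0\<close> by (auto simp: valuation_domain_def dest: spec[of _ "x / y"])
  then obtain a s where as: "a \<in> R" "s \<in> R" "s \<notin> N" "s \<noteq> 0" "y / x = a / s"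
    using N by (rule localization_cases)
  then have "y * s = a * x" using \<open>x \<noteq> 0\<close> by (simp add: field_simps)
  then have "y * s \<in> P" using P'(6) as x by simp
  then show False using P'(5) y as P by blast
qed

text \<open>For \<open>p\<close> in \<open>P\<close> only and \<open>q\<close> in \<open>Q\<close>
  only, \<open>p\<close> becomes a multiple of \<open>q\<close> in the localization at
  \<open>N\<close>, which forces \<open>p\<close> into \<open>Q\<close>.\<close>

lemma primes_comparable:
  assumes V: "valuation_domain (localization R N)" and N: "0 \<in> N"
    and P: "prime_ideal R P" "P \<subseteq> N" and Q: "prime_ideal R Q" "Q \<subseteq> N"
  shows "P \<subseteq> Q \<or> Q \<subseteq> P"
proof (rule ccontr)
  assume "\<not> ?thesis"
  then obtain p q where pq: "p \<in> P" "p \<notin> Q" "q \<in> Q" "q \<notin> P" by blast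
  note P' = prime_idealD[OF P(1)] and Q' = prime_idealD[OF Q(1)]
  have "p / q \<in> localization R N"
    using quotient_mem_localization[OF V N P pq(1) _ pq(4)] pq Q'(2) by blast
  then obtain a s where as: "a \<in> R" "s \<in> R" "s \<notin> N" "s \<noteq> 0" "p / q = a / s"
    using N by (rule localization_cases)
  moreover have "q \<noteq> 0" using pq P'(4) by auto
  ultimately have "p * s = a * q" by (simp add: field_simps)
  then have "p * s \<in> Q" using Q'(6) as pq by simp
  then show False using Q'(5)[of p s] P'(2) pq as Q by blast
qed

text \<open>The primes inside \<open>N\<close> that contain \<open>a\<close> form a chain, so their
  intersection is again prime and is the least of them.\<close>

lemma ex_minimal_prime_within:
  assumes V: "valuation_domain (localization R N)" and N: "prime_ideal R N" "a \<in> N"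
  obtains P where "P \<in> minimal_primes R (submod R hull {a})" "P \<subseteq> N"
proof -
  note N' = prime_idealD[OF N(1)]
  define C where "C = {P. prime_ideal R P \<and> a \<in> P \<and> P \<subseteq> N}"
  let ?P = "\<Inter>C"
  have "N \<in> C" using N by (auto simp: C_def)
  have C: "prime_ideal R P" "a \<in> P" "P \<subseteq> N" if "P \<in> C" for P
    using that by (auto simp: C_def)
  have "submod R ?P"
    using C(1)[THEN prime_idealD(1)] by (auto simp: submod_def)
  moreover have "1 \<notin> ?P" using \<open>N \<in> C\<close> N'(3) by auto
  moreover have "x \<in> ?P \<or> y \<in> ?P" if xy: "x \<in> R" "y \<in> R" "x * y \<in> ?P" for x y
  proof (rule ccontr)
    assume "\<not> ?thesis"
    then obtain P Q where PQ: "P \<in> C" "Q \<in> C" "x \<notin> P" "y \<notin> Q" by auto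
    have "P \<subseteq> Q \<or> Q \<subseteq> P"
      using primes_comparable[OF V N'(4) C(1,3)[OF PQ(1)] C(1,3)[OF PQ(2)]] .
    then obtain P' where "P' \<in> C" "x \<notin> P'" "y \<notin> P'" using PQ by blast
    then show False using xy prime_idealD(5)[OF C(1)] by blast
  qed
  moreover have "?P \<subseteq> R" using \<open>N \<in> C\<close> N'(2) by blast
  ultimately have "prime_ideal R ?P"
    using one unfolding prime_ideal_def is_ideal_def by metis
  then have "?P \<in> minimal_primes R (submod R hull {a})"
    unfolding minimal_primes_hull_iff
  proof (intro conjI allI impI)
    show "a \<in> ?P" using C(2) by blast
    fix Q assume Q: "prime_ideal R Q \<and> a \<in> Q \<and> Q \<subseteq> ?P"
    then have "Q \<subseteq> N" using Inter_lower[OF \<open>N \<in> C\<close>] by (meson subset_trans)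
    then have "Q \<in> C" using Q by (simp add: C_def)
    then show "Q = ?P" using Q by blast
  qed
  then show ?thesis using that \<open>N \<in> C\<close> by blast
qed

text \<open>
  If a nonzero prime \<open>Q\<close> lies strictly below \<open>M\<close>, pick \<open>m \<in> M - Q\<close> and a minimal prime \<open>P\<close> of
  \<open>m\<close> inside \<open>M\<close>.  A finite subset \<open>T\<close> of \<open>P\<close>, containing \<open>m\<close> and avoiding the other minimal
  primes of \<open>m\<close>, satisfies \<open>q * m * (T\<^sup>-\<^sup>1)\<^sup>n \<subseteq> R\<close> for \<open>q \<in> Q\<close>, whence \<open>T\<^sup>-\<^sup>1 = R\<close>.
\<close>

lemma maximal_t_ideal_height_one:
  assumes val: "\<And>N. maximal_t_ideal R N \<Longrightarrow> valuation_domain (localization R N)"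
    and fin: "\<And>a. a \<in> R \<Longrightarrow> finite (minimal_primes R (submod R hull {a}))"
    and cic: "completely_integrally_closed R"
    and M: "maximal_t_ideal R M" and Q: "prime_ideal R Q" "Q \<noteq> {0}" "Q \<subseteq> M"
  shows "Q = M"
proof (rule ccontr)
  assume "Q \<noteq> M"
  then obtain m where m: "m \<in> M" "m \<notin> Q" using Q by blast
  have prime: "prime_ideal R N" if "maximal_t_ideal R N" for N
    using maximal_t_ideal_prime that val by (auto simp: valuation_domain_def)
  note M' = prime_idealD[OF prime[OF M]] and Q' = prime_idealD[OF Q(1)]
  obtain q where q: "q \<in> Q" "q \<noteq> 0" using Q(2) Q'(4) by blast
  have mR: "m \<in> R" and qR: "q \<in> R" using m M' q Q' by auto
  have m0: "m \<noteq> 0" using m Q' by auto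
  define \<P> where "\<P> = minimal_primes R (submod R hull {m})"
  have \<P>: "prime_ideal R P" "m \<in> P" "\<And>Q. prime_ideal R Q \<Longrightarrow> m \<in> Q \<Longrightarrow> Q \<subseteq> P \<Longrightarrow> Q = P"
    if "P \<in> \<P>" for P
    using that unfolding \<P>_def minimal_primes_hull_iff by blast+
  obtain P where P: "P \<in> \<P>" "P \<subseteq> M"
    using ex_minimal_prime_within[OF val[OF M] prime[OF M] m(1)] unfolding \<P>_def by blast
  have "Q \<subseteq> P"
    using primes_comparable[OF val[OF M] M'(4) Q(1,3) \<P>(1)[OF P(1)] P(2)] \<P>(2)[OF P(1)] m by blast
  have "\<exists>u. u \<in> P \<and> u \<notin> P'" if "P' \<in> \<P> - {P}" for P'
    using \<P>(3)[of P' P] \<P>(1,2)[OF P(1)] that by blast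
  then obtain u where u: "\<And>P'. P' \<in> \<P> - {P} \<Longrightarrow> u P' \<in> P \<and> u P' \<notin> P'" by metis
  \<comment> \<open>\<open>T\<close> is finite because \<open>m\<close> has finitely many minimal
    primes, and the only minimal prime of \<open>m\<close> that contains \<open>T\<close> is
    \<open>P\<close>.\<close>
  define T where "T = insert m (u ` (\<P> - {P}))"
  have T: "finite T" "T \<subseteq> P"
    using fin[OF mR] u \<P>(2)[OF P(1)] by (auto simp: T_def \<P>_def)
  have PR: "P \<subseteq> R" using prime_idealD(2)[OF \<P>(1)[OF P(1)]] .
  have "c \<in> R" if c: "c \<in> ideal_inv R T" for c
  proof -
    have "q * m * c ^ n \<in> R" for n
    proof (rule ccontr)
      assume "q * m * c ^ n \<notin> R"
      then obtain N where N: "maximal_t_ideal R N" "q * m * c ^ n \<notin> localization R N"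
        by (rule ex_localization_excluding)
      note N' = prime_idealD[OF prime[OF N(1)]]
      interpret L: fraction_domain "localization R N"
        using val[OF N(1)] by unfold_locales (simp add: valuation_domain_def)
      have RL: "x \<in> localization R N" if "x \<in> R" for x
        using mem_localization[OF N'(3) that] .
      have ct: "c * t \<in> R" if "t \<in> T" for t
        using c that by (auto simp: ideal_inv_def)
      have "q * m * c ^ n \<in> localization R N"
      proof (cases "T \<subseteq> N")
        case False
        then obtain t where t: "t \<in> T" "t \<notin> N" by blast
        then have "c = c * t / t" using N'(4) by auto
        also have "\<dots> \<in> localization R N"
          using t ct T PR by (intro mem_localizationI) auto
        finally show ?thesis using RL mR qR by auto
      next
        case True
        then have "m \<in> N" by (auto simp: T_def)
        then obtain P' where P': "P' \<in> \<P>" "P' \<subseteq> N"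
          using ex_minimal_prime_within[OF val[OF N(1)] prime[OF N(1)]] unfolding \<P>_def by blast
        show ?thesis
        proof (cases "P' = P")
          case True
          \<comment> \<open>As \<open>m\<close> lies outside \<open>Q\<close>, all powers of
            \<open>m\<close> divide \<open>q\<close> locally: the factor \<open>q\<close> pays for
            the denominator in \<open>c ^ n = (c * m) ^ n / m ^ n\<close>.\<close>
          have "q / m ^ n \<in> localization R N"
            using quotient_mem_localization[OF val[OF N(1)] N'(4) Q(1) _ q(1)] \<open>Q \<subseteq> P\<close> P' True
              prime_power[OF Q(1) mR m(2)] mR by blast
          moreover have "m \<in> localization R N" "c * m \<in> localization R N"
            using RL mR ct[of m] by (simp_all add: T_def)
          ultimately have "q / m ^ n * m * (c * m) ^ n \<in> localization R N"
            by (rule L.mult[OF L.mult L.power])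
          then show ?thesis using m0 by (simp add: power_mult_distrib field_simps)
        next
          case False
          define t where "t = u P'"
          have t: "t \<in> T" "t \<notin> P'" "t \<in> R" "t \<noteq> 0"
            using u[of P'] P'(1) False prime_idealD(4)[OF \<P>(1)[OF P'(1)]] PR
            by (auto simp: T_def t_def)
          \<comment> \<open>Now \<open>t\<close> lies outside \<open>P'\<close> and \<open>m\<close>
            inside, so the factor \<open>m\<close> pays for the denominator \<open>t ^ n\<close>.
            Both cases together explain the common denominator \<open>q * m\<close>.\<close>
          have "m / t ^ n \<in> localization R N"
            using quotient_mem_localization[OF val[OF N(1)] N'(4) \<P>(1)[OF P'(1)] P'(2) \<P>(2)[OF P'(1)]]
              prime_power[OF \<P>(1)[OF P'(1)] t(3,2)] t by blast
          moreover have "q \<in> localization R N" "c * t \<in> localization R N"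
            using RL qR ct[OF t(1)] by simp_all
          ultimately have "m / t ^ n * q * (c * t) ^ n \<in> localization R N"
            by (rule L.mult[OF L.mult L.power])
          then show ?thesis using t by (simp add: power_mult_distrib field_simps)
        qed
      qed
      with N show False by simp
    qed
    moreover have "q * m \<noteq> 0" using q m0 by simp
    ultimately show ?thesis using cic unfolding completely_integrally_closed_def by blast
  qed
  \<comment> \<open>The inverse of \<open>T\<close> is contained in \<open>R\<close>, so
    \<open>1\<close> lies in \<open>v_op R T\<close>; but \<open>T\<close> is a finite subset of the
    \<open>t\<close>-ideal \<open>M\<close>.\<close>
  then have "ideal_inv R R \<subseteq> v_op R T"
    unfolding v_op_def by (intro ideal_inv_antimono) auto
  then have "1 \<in> v_op R T" using ideal_inv_self by auto
  moreover have "v_op R T \<subseteq> t_op R M"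
    using T P m0 maximal_t_idealD(7)[OF M] by (intro v_op_subset_t_op[of _ _ m]) (auto simp: T_def)
  ultimately show False using maximal_t_idealD(3,6)[OF M] by auto
qed

text \<open>Strong discreteness yields \<open>p\<close> in the maximal ideal \<open>N\<close> of the
  localization but not in its square, and such a \<open>p\<close> generates \<open>N\<close>. Height
  one excludes nonzero elements divisible by all powers of \<open>p\<close>.\<close>

lemma localization_discrete_valuation_ring:
  assumes V: "strongly_discrete_valuation_domain (localization R M)"
    and M: "maximal_t_ideal R M"
    and height: "\<And>Q. prime_ideal R Q \<Longrightarrow> Q \<noteq> {0} \<Longrightarrow> Q \<subseteq> M \<Longrightarrow> Q = M"
  shows "discrete_valuation_ring (localization R M)"
proof -
  let ?V = "localization R M"
  have val: "x \<in> ?V \<or> inverse x \<in> ?V" if "x \<noteq> 0" for x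
    using V that by (auto simp: strongly_discrete_valuation_domain_def valuation_domain_def)
  interpret V: fraction_domain ?V
    using V by unfold_locales (simp add: strongly_discrete_valuation_domain_def valuation_domain_def)
  note M' = prime_idealD[OF maximal_t_ideal_prime[OF M V.dom]]
  have RV: "x \<in> ?V" if "x \<in> R" for x using mem_localization[OF M'(3) that] .
  define N where "N = {x \<in> ?V. x = 0 \<or> inverse x \<notin> ?V}"
  have nonunit: "x \<in> N" if "x \<in> M" for x
    using inverse_notin_localization[OF M'(1) that] RV M'(2) that by (auto simp: N_def)
  have unit: "inverse s \<in> ?V" if "s \<in> R" "s \<notin> M" for s
    using mem_localizationI[of 1 s M] that by (simp add: divide_inverse)
  have N_cases: "\<exists>a s. a \<in> M \<and> s \<in> R \<and> s \<notin> M \<and> s \<noteq> 0 \<and> x = a / s" if x: "x \<in> N" for x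
  proof -
    obtain a s where as: "a \<in> R" "s \<in> R" "s \<notin> M" "s \<noteq> 0" "x = a / s"
      using x M'(4) localization_cases[of x M] unfolding N_def by blast
    moreover have "a \<in> M"
    proof (rule ccontr)
      assume "a \<notin> M"
      moreover have "a \<noteq> 0" using calculation M'(4) by auto
      moreover have "inverse x = s / a" using as by simp
      ultimately show False using mem_localizationI[of s a M] as that by (auto simp: N_def)
    qed
    ultimately show ?thesis by blast
  qed
  have N_mult: "r * x \<in> N" if "r \<in> ?V" "x \<in> N" for r x
  proof (rule ccontr)
    assume "r * x \<notin> N"
    then have "r * x \<noteq> 0" "inverse (r * x) \<in> ?V"
      using that V.mult[of r x] by (auto simp: N_def)
    then have "r * inverse (r * x) \<in> ?V" using that by auto
    moreover have "r * inverse (r * x) = inverse x" using \<open>r * x \<noteq> 0\<close> by (simp add: field_simps)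
    ultimately have "inverse x \<in> ?V" by (simp only:)
    then show False using that \<open>r * x \<noteq> 0\<close> by (auto simp: N_def)
  qed
  have N_add: "x + y \<in> N" if xy: "x \<in> N" "y \<in> N" for x y
  proof (cases "x = 0 \<or> y = 0")
    case False
    then have "y / x \<in> ?V \<or> x / y \<in> ?V" using val[of "y / x"] by auto
    moreover have "x + y = (1 + y / x) * x" "x + y = (1 + x / y) * y"
      using False by (auto simp: field_simps)
    ultimately show ?thesis using N_mult xy V.add[OF V.one] by metis
  qed (use xy in auto)
  have N_sub: "submod ?V N"
    using N_add N_mult V.zero by (auto simp: submod_def N_def)
  have N_prime: "prime_ideal ?V N"
    unfolding prime_ideal_def
  proof (intro conjI ballI impI)
    show "is_ideal ?V N" using N_sub by (auto simp: is_ideal_def N_def)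
    have "1 \<notin> N" by (simp add: N_def)
    then show "N \<noteq> ?V" using V.one by metis
    fix a b assume ab: "a \<in> ?V" "b \<in> ?V" "a * b \<in> N"
    show "a \<in> N \<or> b \<in> N"
    proof (rule ccontr)
      assume "\<not> ?thesis"
      then have "a \<noteq> 0" "b \<noteq> 0" "inverse a * inverse b \<in> ?V" using ab by (auto simp: N_def)
      then show False using ab by (auto simp: N_def)
    qed
  qed
  obtain z where "z \<in> M" "z \<noteq> 0" using maximal_t_idealD(5)[OF M] M'(4) by blast
  then have "N \<noteq> {0}" using nonunit by blast
  then have "N \<noteq> ideal_prod ?V N N"
    using V N_prime by (auto simp: strongly_discrete_valuation_domain_def)
  moreover have "ideal_prod ?V N N \<subseteq> N"
    unfolding ideal_prod_def
  proof (rule hull_subset_submod[OF _ N_sub])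
    have "N \<subseteq> ?V" by (auto simp: N_def)
    then show "{x * y |x y. x \<in> N \<and> y \<in> N} \<subseteq> N" using N_mult by blast
  qed
  ultimately obtain p where p: "p \<in> N" "p \<notin> ideal_prod ?V N N" by blast
  have p0: "p \<noteq> 0"
    using p submod_hull[of ?V "{x * y |x y. x \<in> N \<and> y \<in> N}"] by (auto simp: submod_def ideal_prod_def)
  have pV: "p \<in> ?V" "inverse p \<notin> ?V" using p p0 by (auto simp: N_def)
  have N_div: "y / p \<in> ?V" if y: "y \<in> N" for y
  proof (rule ccontr)
    assume not: "y / p \<notin> ?V"
    then have "y \<noteq> 0" using V.zero by auto
    then have "p / y \<in> ?V" using val[of "y / p"] not p0 by auto
    moreover have "inverse (p / y) \<notin> ?V" using not by simp
    ultimately have "p / y \<in> N" by (auto simp: N_def)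
    then have "(p / y) * y \<in> ideal_prod ?V N N"
      unfolding ideal_prod_def using y by (intro hull_inc) blast
    then show False using p \<open>y \<noteq> 0\<close> by simp
  qed
  have arch: "\<exists>n. z / p ^ n \<notin> ?V" if z: "z \<in> ?V" "z \<noteq> 0" for z
  proof (rule ccontr)
    assume "\<not> ?thesis"
    then have zn: "z / p ^ n \<in> ?V" for n by blast
    \<comment> \<open>\<open>Q\<close> is the contraction to \<open>R\<close> of the intersection of
      all ideals generated by powers of \<open>p\<close>. It is prime, and if it is nonzero then
      height one makes it equal to \<open>M\<close>.\<close>
    define Q where "Q = {a \<in> R. \<forall>n. a / p ^ n \<in> ?V}"
    have "prime_ideal R Q"
      unfolding prime_ideal_def
    proof (intro conjI ballI impI)
      have "(x + y) / p ^ n \<in> ?V" if "x / p ^ n \<in> ?V" "y / p ^ n \<in> ?V" for x y n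
        using V.add[OF that] by (simp add: add_divide_distrib)
      moreover have "r * x / p ^ n \<in> ?V" if "r \<in> R" "x / p ^ n \<in> ?V" for r x n
        using V.mult[OF RV[OF that(1)] that(2)] by simp
      ultimately show "is_ideal R Q"
        using V.zero add mult by (auto simp: is_ideal_def submod_def Q_def)
      have "1 / p ^ 1 \<notin> ?V" using pV by (simp add: divide_inverse)
      then have "1 \<notin> Q" unfolding Q_def by blast
      then show "Q \<noteq> R" by auto
      fix a b assume ab: "a \<in> R" "b \<in> R" "a * b \<in> Q"
      show "a \<in> Q \<or> b \<in> Q"
      proof (rule ccontr)
        assume "\<not> ?thesis"
        then obtain i j where ij: "a / p ^ i \<notin> ?V" "b / p ^ j \<notin> ?V" using ab by (auto simp: Q_def)
        then have "a \<noteq> 0" "b \<noteq> 0" using V.zero by auto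
        have "p ^ i / a \<in> ?V" "p ^ j / b \<in> ?V"
          using ij val[of "a / p ^ i"] val[of "b / p ^ j"] \<open>a \<noteq> 0\<close> \<open>b \<noteq> 0\<close> p0 by auto
        \<comment> \<open>The exponent exceeds \<open>i + j\<close> by one, which leaves a single
          factor \<open>p\<close> to be inverted.\<close>
        moreover have "a * b / p ^ Suc (i + j) \<in> ?V" using ab unfolding Q_def by blast
        ultimately have "(p ^ i / a) * (p ^ j / b) * (a * b / p ^ Suc (i + j)) \<in> ?V"
          by (rule V.mult[OF V.mult])
        moreover have "(p ^ i / a) * (p ^ j / b) * (a * b / p ^ Suc (i + j)) = inverse p"
          using \<open>a \<noteq> 0\<close> \<open>b \<noteq> 0\<close> p0 by (simp add: power_add field_simps)
        ultimately have "inverse p \<in> ?V" by (simp only:)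
        then show False using pV by simp
      qed
    qed
    moreover have "Q \<noteq> {0}"
    proof -
      obtain a s where as: "a \<in> R" "s \<in> R" "s \<notin> M" "s \<noteq> 0" "z = a / s"
        using z(1) M'(4) by (rule localization_cases)
      have "a / p ^ n = s * (z / p ^ n)" for n using as by simp
      moreover have "s * (z / p ^ n) \<in> ?V" for n using V.mult[OF RV[OF as(2)] zn] .
      ultimately have "a / p ^ n \<in> ?V" for n by (simp only:)
      then have "a \<in> Q" using as(1) by (simp add: Q_def)
      moreover have "a \<noteq> 0" using as z by auto
      ultimately show ?thesis by blast
    qed
    moreover have "Q \<subseteq> M"
    proof
      fix a assume a: "a \<in> Q"
      show "a \<in> M"
      proof (rule ccontr)
        assume "a \<notin> M"
        then have "inverse a \<in> ?V" "a \<noteq> 0" "a / p \<in> ?V"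
          using unit a M'(4) by (auto simp: Q_def dest: spec[of _ "1::nat"])
        then have "inverse a * (a / p) \<in> ?V" by blast
        moreover have "inverse a * (a / p) = inverse p"
          using \<open>a \<noteq> 0\<close> by (simp add: field_simps)
        ultimately have "inverse p \<in> ?V" by (simp only:)
        then show False using pV by simp
      qed
    qed
    ultimately have "Q = M" by (rule height)
    \<comment> \<open>With \<open>Q = M\<close> the numerator \<open>a = p * s\<close> would be
      divisible by \<open>p ^ 2\<close>, which makes \<open>p\<close> a unit.\<close>
    obtain a s where as: "a \<in> M" "s \<in> R" "s \<notin> M" "s \<noteq> 0" "p = a / s"
      using N_cases[OF p(1)] by blast
    then have "a / p ^ 2 \<in> ?V" using \<open>Q = M\<close> by (auto simp: Q_def)
    then have "inverse s * (a / p ^ 2) \<in> ?V" using unit as by blast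
    moreover have "inverse s * (a / p ^ 2) = inverse p"
      using as p0 by (auto simp: power2_eq_square field_simps)
    ultimately show False using pV by simp
  qed
  have rep_V: "\<exists>k::nat. x / p ^ k \<in> ?V \<and> inverse (x / p ^ k) \<in> ?V" if x: "x \<in> ?V" "x \<noteq> 0" for x
  proof -
    \<comment> \<open>At the exponent just before the first failure, the quotient lies outside
      \<open>N\<close> and hence is a unit.\<close>
    obtain n where n: "x / p ^ n \<notin> ?V" "\<And>k. k < n \<Longrightarrow> x / p ^ k \<in> ?V"
      using exists_least_iff[of "\<lambda>n. x / p ^ n \<notin> ?V"] arch[OF x] by auto
    then obtain k where k: "n = Suc k" using x by (cases n) auto
    have "x / p ^ k / p \<notin> ?V" using n(1) k by (simp add: mult.commute)
    then have "x / p ^ k \<notin> N" using N_div by blast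
    then show ?thesis using n(2)[of k] k by (auto simp: N_def)
  qed
  show ?thesis
  proof (rule discrete_valuation_ringI)
    fix x :: 'k assume x: "x \<noteq> 0"
    show "\<exists>k::int. x / p powi k \<in> ?V \<and> inverse (x / p powi k) \<in> ?V"
    proof (cases "x \<in> ?V")
      case True
      then obtain k where "x / p ^ k \<in> ?V \<and> inverse (x / p ^ k) \<in> ?V" using rep_V x by blast
      then show ?thesis by (intro exI[of _ "int k"]) simp
    next
      case False
      then obtain k where "inverse x / p ^ k \<in> ?V \<and> inverse (inverse x / p ^ k) \<in> ?V"
        using rep_V[of "inverse x"] val[OF x] x by auto
      then show ?thesis
        by (intro exI[of _ "- int k"]) (simp add: power_int_minus divide_inverse mult.commute)
    qed
  qed (use pV V.one V.diff V.mult in auto)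
qed

text \<open>Finite character comes from minimal primes: by height one, a maximal
  \<open>t\<close>-ideal containing \<open>c \<noteq> 0\<close> is a minimal prime of
  \<open>c\<close>, and \<open>x = a / b\<close> is a unit at every maximal \<open>t\<close>-ideal
  avoiding \<open>a\<close> and \<open>b\<close>.\<close>

lemma krull_domain_if_completely_integrally_closed:
  assumes R: "krull_like_PVMD R" and cic: "completely_integrally_closed R"
  shows "krull_domain R"
proof -
  have V: "strongly_discrete_valuation_domain (localization R N)" if "maximal_t_ideal R N" for N
    using R that by (auto simp: krull_like_PVMD_def)
  then have val: "valuation_domain (localization R N)" if "maximal_t_ideal R N" for N
    using that by (auto simp: strongly_discrete_valuation_domain_def)
  have fin: "finite (minimal_primes R (submod R hull {a}))" if "a \<in> R" for a
    using R that by (auto simp: krull_like_PVMD_def)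
  have height: "Q = M" if "maximal_t_ideal R M" "prime_ideal R Q" "Q \<noteq> {0}" "Q \<subseteq> M" for M Q
    by (rule maximal_t_ideal_height_one[OF _ _ cic that]) (use val fin in blast)+
  have prime: "prime_ideal R N" if "maximal_t_ideal R N" for N
    using maximal_t_ideal_prime that val by (auto simp: valuation_domain_def)
  let ?F = "localization R ` {M. maximal_t_ideal R M}"
  have "discrete_valuation_ring V" if "V \<in> ?F" for V
    using that localization_discrete_valuation_ring[OF V _ height] by auto
  moreover have "R = \<Inter>?F"
  proof
    show "R \<subseteq> \<Inter>?F" using mem_localization maximal_t_idealD(3) by blast
    show "\<Inter>?F \<subseteq> R" using ex_localization_excluding by blast
  qed
  moreover have "finite {V \<in> ?F. \<not> (x \<in> V \<and> inverse x \<in> V)}" if x: "x \<noteq> 0" for x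
  proof -
    obtain a b where ab: "a \<in> R" "b \<in> R" "b \<noteq> 0" "x = a / b" by (rule quotient_rep)
    then have "a \<noteq> 0" using x by auto
    let ?A = "minimal_primes R (submod R hull {a}) \<union> minimal_primes R (submod R hull {b})"
    have min: "M \<in> minimal_primes R (submod R hull {c})"
      if "maximal_t_ideal R M" "c \<in> M" "c \<noteq> 0" for M c
    proof -
      have "Q = M" if "prime_ideal R Q" "c \<in> Q" "Q \<subseteq> M" for Q
        using height[OF \<open>maximal_t_ideal R M\<close> that(1) _ that(3)] that(2) \<open>c \<noteq> 0\<close> by blast
      then show ?thesis
        using that prime unfolding minimal_primes_hull_iff by blast
    qed
    have "{V \<in> ?F. \<not> (x \<in> V \<and> inverse x \<in> V)} \<subseteq> localization R ` ?A"
    proof clarify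
      fix M assume M: "maximal_t_ideal R M" and not: "\<not> (x \<in> localization R M \<and> inverse x \<in> localization R M)"
      have "a \<in> M \<or> b \<in> M"
      proof (rule ccontr)
        assume "\<not> ?thesis"
        then have "x \<in> localization R M" "inverse x \<in> localization R M"
          using ab mem_localizationI[of a b M] mem_localizationI[of b a M] by auto
        with not show False by simp
      qed
      then show "localization R M \<in> localization R ` ?A"
        using min[OF M] ab \<open>a \<noteq> 0\<close> by auto
    qed
    moreover have "finite (localization R ` ?A)" using fin ab(1,2) by simp
    ultimately show ?thesis by (rule finite_subset)
  qed
  ultimately show ?thesis unfolding krull_domain_def
    using dom by (intro conjI exI[of _ ?F] ballI allI impI)
qed

end

subsection \<open>Power series and complete integral closure\<close>

text \<open>The convolution recurrence is the form that squaring a power series produces.\<close>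

fun catalan :: "nat \<Rightarrow> nat" where
  "catalan 0 = 1"
| "catalan (Suc n) = (\<Sum>i\<le>n. catalan i * catalan (n - i))"

text \<open>
  The series \<open>Z = \<Sum>n. catalan n * w n * X ^ (n + 1)\<close> is a constant multiple \<open>q * z\<close> of a root of
  \<open>z\<^sup>2 - a * z + b * X\<close>.
\<close>

lemma catalan_series_quadratic:
  fixes a b q :: "'a::idom" and w :: "nat \<Rightarrow> 'a"
  assumes w: "\<And>i j. w i * w j = a * q * w (Suc (i + j))" and w0: "a * w 0 = q * b"
  defines "Z \<equiv> Abs_fps (\<lambda>n. case n of 0 \<Rightarrow> 0 | Suc m \<Rightarrow> of_nat (catalan m) * w m)"
  shows "Z ^ 2 - fps_const (a * q) * Z + fps_const (q ^ 2 * b) * fps_X = 0"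
proof (rule fps_ext)
  fix n
  define z where "z n = (case n of 0 \<Rightarrow> 0 | Suc m \<Rightarrow> of_nat (catalan m) * w m)" for n
  have Z: "Z $ n = z n" for n by (simp add: Z_def z_def)
  have sq: "(Z ^ 2) $ n = (\<Sum>i=0..n. z i * z (n - i))"
    by (simp add: power2_eq_square fps_mult_nth Z)
  \<comment> \<open>The coefficient of \<open>X\<close> vanishes by \<open>w0\<close>; all higher
    ones cancel by the Catalan recurrence combined with the product rule \<open>w\<close>.\<close>
  have "(\<Sum>i=0..n. z i * z (n - i)) - a * q * z n + (if n = 1 then q ^ 2 * b else 0) = 0"
  proof (cases n)
    case 0
    then show ?thesis by (simp add: z_def)
  next
    case (Suc m)
    show ?thesis
    proof (cases m)
      case 0
      then show ?thesis using Suc w0 by (simp add: z_def power2_eq_square)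
    next
      case m: (Suc k)
      have "(\<Sum>i=0..n. z i * z (n - i)) = (\<Sum>i=1..Suc k. z i * z (n - i))"
      proof (rule sum.mono_neutral_right)
        show "\<forall>i\<in>{0..n} - {1..Suc k}. z i * z (n - i) = 0"
        proof
          fix i assume "i \<in> {0..n} - {1..Suc k}"
          then have "i = 0 \<or> i = n" using Suc m by auto
          then show "z i * z (n - i) = 0" by (auto simp: z_def)
        qed
      qed (use Suc m in auto)
      also have "\<dots> = (\<Sum>i=0..k. z (Suc i) * z (n - Suc i))"
        unfolding One_nat_def by (rule sum.shift_bounds_cl_Suc_ivl)
      also have "\<dots> = (\<Sum>i=0..k. of_nat (catalan i * catalan (k - i)) * (a * q * w (Suc k)))"
      proof (rule sum.cong)
        fix i assume "i \<in> {0..k}"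
        then have i: "n - Suc i = Suc (k - i)" "w i * w (k - i) = a * q * w (Suc k)"
          using Suc m w[of i "k - i"] by auto
        show "z (Suc i) * z (n - Suc i) = of_nat (catalan i * catalan (k - i)) * (a * q * w (Suc k))"
          unfolding i(1) i(2)[symmetric] by (simp add: z_def mult_ac)
      qed simp
      also have "\<dots> = a * q * z n"
        using Suc m by (simp add: z_def atMost_atLeast0 sum_distrib_right sum_distrib_left mult_ac)
      finally show ?thesis using Suc m by simp
    qed
  qed
  then show "(Z ^ 2 - fps_const (a * q) * Z + fps_const (q ^ 2 * b) * fps_X) $ n = 0 $ n"
    unfolding fps_add_nth fps_sub_nth fps_mult_left_const_nth fps_X_nth sq Z
    by (cases "n = 1") auto
qed

section \<open>Almost integral elements and integrality over the power series ring\<close>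

lemma to_fract_power: "to_fract (x ^ n) = to_fract x ^ n"
  by (induction n) (simp_all add: to_fract_mult)

lemma dom_of_iff: "x \<in> dom_of TYPE('a::idom) \<longleftrightarrow> (\<exists>a. x = to_fract a)"
  by (auto simp: dom_of_def)

lemma to_fract_in_dom_of [simp]: "to_fract (a::'a::idom) \<in> dom_of TYPE('a)"
  by (simp add: dom_of_iff)

lemma fract_cases_quotient:
  fixes x :: "'a::idom fract"
  obtains a b where "b \<noteq> 0" "x = to_fract a / to_fract b"
  by (cases x) (auto simp: Fract_conv_to_fract)

text \<open>Valuation rings are integrally closed: if \<open>x\<close> is missing from one, its
  inverse is present, and so is \<open>x = a - b * inverse x\<close>.\<close>

lemma monic_quadratic_root_mem:
  fixes x :: "'k::field"
  assumes "fraction_domain R"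
    and val: "\<And>M. maximal_t_ideal R M \<Longrightarrow> valuation_domain (localization R M)"
    and ab: "a \<in> R" "b \<in> R" and x: "x ^ 2 - a * x + b = 0"
  shows "x \<in> R"
proof (rule ccontr)
  interpret fraction_domain R by fact
  assume "x \<notin> R"
  then obtain M where M: "maximal_t_ideal R M" "x \<notin> localization R M"
    by (rule ex_localization_excluding)
  interpret L: fraction_domain "localization R M"
    using val[OF M(1)] by unfold_locales (simp add: valuation_domain_def)
  have "x \<noteq> 0" using M(2) by auto
  then have "inverse x \<in> localization R M"
    using M val[OF M(1)] by (auto simp: valuation_domain_def)
  then have "a - b * inverse x \<in> localization R M"
    using ab mem_localization[OF maximal_t_idealD(3)[OF M(1)]] by (intro L.diff L.mult) auto
  moreover have "a - b * inverse x = x"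
    using x \<open>x \<noteq> 0\<close> by (simp add: field_simps power2_eq_square)
  ultimately show False using M(2) by simp
qed

text \<open>The Catalan series is handled as \<open>Z / Q\<close> with \<open>Z\<close> in D[[X]].
  Being integral, it lies in D[[X]], so \<open>Z\<close> is a multiple of \<open>Q\<close> there,
  and the linear coefficient of the quotient is \<open>a * c\<close>.\<close>

lemma almost_integral_reduction:
  fixes a :: "'a::idom" and c :: "'a fract"
  assumes val: "\<And>M. maximal_t_ideal (dom_of TYPE('a fps)) M \<Longrightarrow>
      valuation_domain (localization (dom_of TYPE('a fps)) M)"
    and q: "q \<noteq> 0" "\<And>n. to_fract q * c ^ n \<in> dom_of TYPE('a)"
    and a: "to_fract a ^ 2 * c \<in> dom_of TYPE('a)"
  shows "to_fract a * c \<in> dom_of TYPE('a)"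
proof -
  let ?R = "dom_of TYPE('a)" and ?S = "dom_of TYPE('a fps)"
  interpret R: fraction_domain ?R by standard (rule domain_in_field_dom_of)
  have S: "fraction_domain ?S" by standard (rule domain_in_field_dom_of)
  obtain b where b: "to_fract a ^ 2 * c = to_fract b" using a by (auto simp: dom_of_iff)
  have "\<exists>w. to_fract w = to_fract q * to_fract a * c ^ Suc n" for n
    using q(2)[of "Suc n"] R.mult[of "to_fract a" "to_fract q * c ^ Suc n"]
    by (auto simp: dom_of_iff mult_ac)
  \<comment> \<open>The factor \<open>q\<close> absorbs the denominators of all powers of
    \<open>c\<close> at once; the relations \<open>ww\<close> and \<open>w0\<close> are then
    computed in the quotient field and pulled back.\<close>
  then obtain w where w: "\<And>n. to_fract (w n) = to_fract q * to_fract a * c ^ Suc n" by metis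
  define Z where "Z = Abs_fps (\<lambda>n. case n of 0 \<Rightarrow> 0 | Suc m \<Rightarrow> of_nat (catalan m) * w m)"
  have "to_fract (w i * w j) = to_fract (a * q * w (Suc (i + j)))" for i j
    by (simp add: to_fract_mult w power_add mult_ac)
  then have ww: "w i * w j = a * q * w (Suc (i + j))" for i j
    by (simp only: to_fract_eq_iff)
  have "to_fract (a * w 0) = to_fract (q * b)"
    by (simp add: to_fract_mult w flip: b) (simp add: power2_eq_square mult_ac)
  then have w0: "a * w 0 = q * b" by (simp only: to_fract_eq_iff)
  have Z: "Z ^ 2 - fps_const (a * q) * Z + fps_const (q ^ 2 * b) * fps_X = 0"
    unfolding Z_def by (rule catalan_series_quadratic[OF ww w0])
  define Q where "Q = fps_const q"
  have Q0: "Q \<noteq> 0" using q by (simp add: Q_def)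
  define z where "z = to_fract Z / to_fract Q"
  have "to_fract (Z ^ 2 - fps_const a * Q * Z + Q ^ 2 * (fps_const b * fps_X)) = 0"
    using Z by (simp add: Q_def fps_const_power power2_eq_square mult_ac flip: fps_const_mult)
  then have "(to_fract Z ^ 2 - to_fract (fps_const a) * to_fract Q * to_fract Z
      + to_fract Q ^ 2 * to_fract (fps_const b * fps_X)) / to_fract Q ^ 2 = 0"
    unfolding to_fract_add to_fract_diff to_fract_mult to_fract_power by simp
  then have "z ^ 2 - to_fract (fps_const a) * z + to_fract (fps_const b * fps_X) = 0"
    using Q0 by (simp add: z_def field_simps power2_eq_square)
  then have "z \<in> ?S"
    by (rule monic_quadratic_root_mem[OF S, rotated 3]) (rule to_fract_in_dom_of val | assumption)+
  then obtain G where "z = to_fract G" by (auto simp: dom_of_iff)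
  then have "to_fract Z = to_fract (Q * G)" using Q0 by (simp add: z_def field_simps to_fract_mult)
  then have "Z = Q * G" by (simp only: to_fract_eq_iff)
  \<comment> \<open>Since \<open>catalan 0 = 1\<close>, the coefficient of \<open>X\<close> isolates
    \<open>w 0\<close>, which is \<open>q * a * c\<close>.\<close>
  then have "Z $ 1 = q * G $ 1" by (simp add: Q_def)
  then have "w 0 = q * G $ 1" by (simp add: Z_def)
  then have "to_fract (w 0) = to_fract q * to_fract (G $ 1)" by simp
  then have "to_fract q * (to_fract a * c) = to_fract q * to_fract (G $ 1)"
    using w[of 0] by (simp only: mult.assoc power_Suc0_right)
  moreover have "to_fract q \<noteq> 0" using q(1) by simp
  ultimately have "to_fract a * c = to_fract (G $ 1)" by (metis mult_left_cancel)
  then show ?thesis by simp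
qed

lemma completely_integrally_closed_if_fps_valuation:
  assumes val: "\<And>M. maximal_t_ideal (dom_of TYPE('a::idom)) M \<Longrightarrow>
      valuation_domain (localization (dom_of TYPE('a)) M)"
    and val_fps: "\<And>M. maximal_t_ideal (dom_of TYPE('a fps)) M \<Longrightarrow>
      valuation_domain (localization (dom_of TYPE('a fps)) M)"
  shows "completely_integrally_closed (dom_of TYPE('a))"
  unfolding completely_integrally_closed_def
proof (intro allI impI, elim conjE)
  let ?R = "dom_of TYPE('a)"
  interpret fraction_domain ?R by standard (rule domain_in_field_dom_of)
  fix c q :: "'a fract" assume q: "q \<noteq> 0" "\<forall>n. q * c ^ n \<in> ?R"
  show "c \<in> ?R"
  proof (rule ccontr)
    assume "c \<notin> ?R"
    then obtain M where M: "maximal_t_ideal ?R M" "c \<notin> localization ?R M"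
      by (rule ex_localization_excluding)
    note M' = maximal_t_idealD[OF M(1)]
    interpret L: fraction_domain "localization ?R M"
      using val[OF M(1)] by unfold_locales (simp add: valuation_domain_def)
    have "c \<noteq> 0" using M(2) by auto
    then have "inverse c \<in> localization ?R M"
      using M val[OF M(1)] by (auto simp: valuation_domain_def)
    then obtain r s where rs: "r \<in> ?R" "s \<in> ?R" "s \<notin> M" "s \<noteq> 0" "inverse c = r / s"
      using M'(4) by (rule localization_cases)
    then have c: "c = s / r" and "r \<noteq> 0" using \<open>c \<noteq> 0\<close> by (auto simp: field_simps)
    have "r \<in> M"
    proof (rule ccontr)
      assume "r \<notin> M"
      then show False using mem_localizationI[of s r M] M(2) rs c by simp
    qed
    obtain a where a: "r = to_fract a" using rs(1) by (auto simp: dom_of_iff)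
    obtain q' where q': "q = to_fract q'" using q(2) by (auto simp: dom_of_iff dest: spec[of _ 0])
    \<comment> \<open>For \<open>c = s / r\<close> and \<open>a = r\<close>, the reduction applied
      to \<open>c\<close> itself would only return \<open>s\<close>. Applied to \<open>c ^ 2\<close>
      it starts from \<open>s ^ 2\<close> and returns \<open>s ^ 2 / r\<close>, which is impossible
      at \<open>M\<close> because \<open>s\<close> is a unit there and \<open>r\<close> lies in
      \<open>M\<close>.\<close>
    have "to_fract a * c ^ 2 \<in> ?R"
    proof (rule almost_integral_reduction[OF val_fps])
      show "q' \<noteq> 0" using q q' by auto
      show "to_fract q' * (c ^ 2) ^ n \<in> ?R" for n
        using q(2) by (simp add: q' flip: power_mult)
      have "to_fract a ^ 2 * c ^ 2 = s ^ 2"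
        using c a \<open>r \<noteq> 0\<close> by (simp add: power_divide)
      then show "to_fract a ^ 2 * c ^ 2 \<in> ?R" using rs(2) by auto
    qed
    moreover have "to_fract a * c ^ 2 = s * s / r"
      using c a \<open>r \<noteq> 0\<close> by (simp add: power2_eq_square)
    ultimately have "s * s / r \<in> localization ?R M"
      using mem_localization[OF M'(3)] by simp
    moreover have "inverse s \<in> localization ?R M"
      using mem_localizationI[of 1 s M] rs by (simp add: divide_inverse)
    ultimately have "inverse s * (inverse s * (s * s / r)) \<in> localization ?R M" by blast
    moreover have "inverse s * (inverse s * (s * s / r)) = inverse r"
      using rs(4) \<open>r \<noteq> 0\<close> by (simp add: field_simps)
    ultimately have "inverse r \<in> localization ?R M" by (simp only:)
    then show False using inverse_notin_localization[OF M'(1) \<open>r \<in> M\<close> \<open>r \<noteq> 0\<close>] by simp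
  qed
qed

subsection \<open>Krull domains are Krull-like PVMDs\<close>

text \<open>
  Unlike in the definition of a Krull domain, the valuations need be neither normalized nor
  nontrivial: restrictions of normalized valuations to smaller fields may be neither.
\<close>

definition krull_valuations :: "'k::field set \<Rightarrow> ('k \<Rightarrow> int) set \<Rightarrow> bool" where
  "krull_valuations R W \<longleftrightarrow>
     (\<forall>v\<in>W. int_valuation v) \<and> (\<forall>x. x \<in> R \<longleftrightarrow> x = 0 \<or> (\<forall>v\<in>W. v x \<ge> 0)) \<and>
     (\<forall>x. x \<noteq> 0 \<longrightarrow> finite {v \<in> W. v x \<noteq> 0})"

lemma krull_domain_krull_valuations:
  assumes "krull_domain R"
  shows "\<exists>W. krull_valuations R W"
proof -
  obtain F where F: "\<And>V. V \<in> F \<Longrightarrow> discrete_valuation_ring V" "R = \<Inter>F"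
    "\<And>x. x \<noteq> 0 \<Longrightarrow> finite {V \<in> F. \<not> (x \<in> V \<and> inverse x \<in> V)}"
    using assms by (auto simp: krull_domain_def)
  have "\<forall>V\<in>F. \<exists>v. discrete_valuation v \<and> V = {x. x = 0 \<or> v x \<ge> 0}"
    using F(1) by (simp add: discrete_valuation_ring_def)
  then obtain v where "\<forall>V\<in>F. discrete_valuation (v V) \<and> V = {x. x = 0 \<or> v V x \<ge> 0}"
    by metis
  then have v: "discrete_valuation (v V)" and V_iff: "x \<in> V \<longleftrightarrow> x = 0 \<or> v V x \<ge> 0"
    if "V \<in> F" for V x
    using that by blast+
  have iv: "int_valuation (v V)" if "V \<in> F" for V
    using v[OF that] by (rule discrete_valuation_int_valuation)
  have "finite {w \<in> v ` F. w x \<noteq> 0}" if "x \<noteq> 0" for x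
  proof (rule finite_subset)
    show "{w \<in> v ` F. w x \<noteq> 0} \<subseteq> v ` {V \<in> F. \<not> (x \<in> V \<and> inverse x \<in> V)}"
      using V_iff int_valuation_inverse[OF iv that] that by fastforce
  qed (use F(3)[OF that] in simp)
  then have "krull_valuations R (v ` F)"
    using iv V_iff by (auto simp: krull_valuations_def F(2))
  then show ?thesis ..
qed

locale krull_valuation_family = fraction_domain R for R :: "'k::field set" +
  fixes W :: "('k \<Rightarrow> int) set"
  assumes W: "krull_valuations R W"
begin

lemma val: "v \<in> W \<Longrightarrow> int_valuation v"
  and mem_iff: "x \<in> R \<longleftrightarrow> x = 0 \<or> (\<forall>v\<in>W. v x \<ge> 0)"
  and finite_nonzero: "x \<noteq> 0 \<Longrightarrow> finite {v \<in> W. v x \<noteq> 0}"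
  using W unfolding krull_valuations_def by blast+

lemma val_nonneg: "v \<in> W \<Longrightarrow> x \<in> R \<Longrightarrow> x \<noteq> 0 \<Longrightarrow> v x \<ge> 0"
  using mem_iff by blast

lemma completely_integrally_closed: "completely_integrally_closed R"
  unfolding completely_integrally_closed_def
proof (intro allI impI, elim conjE)
  fix c q :: 'k assume q: "q \<noteq> 0" "\<forall>n. q * c ^ n \<in> R"
  show "c \<in> R"
  proof (cases "c = 0")
    case False
    have "v c \<ge> 0" if v: "v \<in> W" for v
    proof (rule ccontr)
      assume neg: "\<not> v c \<ge> 0"
      \<comment> \<open>Since \<open>v c \<le> -1\<close>, any exponent above \<open>v q\<close>
        makes the value of \<open>q * c ^ n\<close> negative.\<close>
      define n where "n = nat (v q) + 1"
      have "v (q * c ^ n) = v q + int n * v c"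
        using int_valuation_mult[OF val[OF v]] int_valuation_power[OF val[OF v]] q False by simp
      also have "\<dots> \<le> v q + int n * (- 1)"
        using neg by (intro add_left_mono mult_left_mono) auto
      also have "\<dots> < 0" by (simp add: n_def)
      finally show False using val_nonneg[OF v q(2)[rule_format, of n]] q(1) False by simp
    qed
    then show ?thesis using mem_iff by blast
  qed simp
qed

text \<open>Where \<open>v a = 0\<close>, the element \<open>a\<close> already has least value in
  \<open>A\<close>; for the finitely many remaining \<open>v\<close> one minimizer each is added.
  The finite set \<open>S\<close> then stands in for \<open>A\<close> in all divisibility
  questions.\<close>

lemma ex_finite_min_values:
  assumes A: "A \<subseteq> R" "a \<in> A" "a \<noteq> 0"
  obtains S where "finite S" "S \<subseteq> A" "a \<in> S"
    "\<And>v x. v \<in> W \<Longrightarrow> x \<in> A \<Longrightarrow> x \<noteq> 0 \<Longrightarrow> \<exists>s\<in>S. s \<noteq> 0 \<and> v s \<le> v x"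
proof -
  have "\<exists>s. s \<in> A \<and> s \<noteq> 0 \<and> (\<forall>x. x \<in> A \<and> x \<noteq> 0 \<longrightarrow> v s \<le> v x)" if v: "v \<in> W" for v
  proof -
    obtain s where s: "s \<in> A" "s \<noteq> 0" "\<And>x. x \<in> A \<and> x \<noteq> 0 \<Longrightarrow> nat (v s) \<le> nat (v x)"
      using ex_has_least_nat[of "\<lambda>x. x \<in> A \<and> x \<noteq> 0" a "\<lambda>x. nat (v x)"] A by blast
    have "v s \<le> v x" if "x \<in> A" "x \<noteq> 0" for x
      using s(3)[of x] val_nonneg[OF v, of s] val_nonneg[OF v, of x] that s A
      by (metis in_mono nat_le_eq_zle order_antisym_conv order_less_le)
    then show ?thesis using s by blast
  qed
  then obtain s where s: "\<And>v. v \<in> W \<Longrightarrow> s v \<in> A \<and> s v \<noteq> 0 \<and> (\<forall>x. x \<in> A \<and> x \<noteq> 0 \<longrightarrow> v (s v) \<le> v x)"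
    by metis
  define S where "S = insert a (s ` {v \<in> W. v a \<noteq> 0})"
  have "finite S" "S \<subseteq> A" "a \<in> S"
    using finite_nonzero[OF A(3)] s A by (auto simp: S_def)
  moreover have "\<exists>s\<in>S. s \<noteq> 0 \<and> v s \<le> v x" if "v \<in> W" "x \<in> A" "x \<noteq> 0" for v x
  proof (cases "v a = 0")
    case True
    then show ?thesis
      using val_nonneg[OF that(1), of x] A that by (intro bexI[of _ a]) (auto simp: S_def)
  next
    case False
    then show ?thesis using s[OF that(1)] that by (intro bexI[of _ "s v"]) (auto simp: S_def)
  qed
  ultimately show ?thesis using that by blast
qed

text \<open>Membership in \<open>R\<close> is a condition on values, and \<open>v (c * x)\<close> is
  at least \<open>v (c * s)\<close> when \<open>s\<close> minimizes \<open>v\<close>.\<close>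

lemma ideal_inv_eq_if_min_values:
  assumes S: "S \<subseteq> A" "\<And>v x. v \<in> W \<Longrightarrow> x \<in> A \<Longrightarrow> x \<noteq> 0 \<Longrightarrow> \<exists>s\<in>S. s \<noteq> 0 \<and> v s \<le> v x"
  shows "ideal_inv R S = ideal_inv R A"
proof
  show "ideal_inv R A \<subseteq> ideal_inv R S" using S(1) by (rule ideal_inv_antimono)
  show "ideal_inv R S \<subseteq> ideal_inv R A"
  proof
    fix c assume c: "c \<in> ideal_inv R S"
    have "c * x \<in> R" if x: "x \<in> A" for x
    proof (cases "c = 0 \<or> x = 0")
      case False
      have "v (c * x) \<ge> 0" if v: "v \<in> W" for v
      proof -
        obtain s where s: "s \<in> S" "s \<noteq> 0" "v s \<le> v x" using S(2)[OF v x] False by blast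
        then have "v (c * s) \<ge> 0" using val_nonneg[OF v] c False by (auto simp: ideal_inv_def)
        then show ?thesis using int_valuation_mult[OF val[OF v]] s False by simp
      qed
      then show ?thesis using mem_iff by blast
    qed auto
    then show "c \<in> ideal_inv R A" by (simp add: ideal_inv_def)
  qed
qed

text \<open>A finite subset has the same inverse as \<open>A\<close>, so the \<open>t\<close>- and
  \<open>v\<close>-operations agree on nonzero integral ideals of a Krull domain.\<close>

lemma v_op_subset_t_op_ideal:
  assumes "submod R A" "A \<subseteq> R" "A \<noteq> {0}"
  shows "v_op R A \<subseteq> t_op R A"
proof -
  obtain a where a: "a \<in> A" "a \<noteq> 0" using assms submod_zero by blast
  obtain S where S: "finite S" "S \<subseteq> A" "a \<in> S"
    "\<And>v x. v \<in> W \<Longrightarrow> x \<in> A \<Longrightarrow> x \<noteq> 0 \<Longrightarrow> \<exists>s\<in>S. s \<noteq> 0 \<and> v s \<le> v x"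
    using ex_finite_min_values[OF assms(2) a] by blast
  have "v_op R S \<subseteq> t_op R A"
    using S a frac_ideal_integral[OF assms(1,2)] by (intro v_op_subset_t_op[of _ _ a]) auto
  then show ?thesis
    using ideal_inv_eq_if_min_values[OF S(2,4)] by (simp add: v_op_def)
qed

lemma ideal_inv_if_power_closed:
  assumes "A \<subseteq> R" "a \<in> A" "a \<noteq> 0" "\<And>x. x \<in> A \<Longrightarrow> c * x \<in> A"
  shows "c \<in> R"
proof -
  have "a * c ^ n \<in> A" for n
    by (induction n) (use assms(2,4) in \<open>auto simp: mult.left_commute[of a]\<close>)
  then show ?thesis
    using completely_integrally_closed assms unfolding completely_integrally_closed_def by blast
qed

text \<open>An element \<open>c\<close> of the inverse of \<open>A = I I^{-1}\<close> maps the
  inverse of \<open>I\<close> into itself. Starting from \<open>1\<close>, all powers of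
  \<open>c\<close> stay in that inverse, so complete integral closedness gives
  \<open>c \<in> R\<close>, and \<open>A\<close> has trivial \<open>v\<close>-closure.\<close>

lemma PVMD: "PVMD R"
  unfolding PVMD_def
proof (intro conjI dom allI impI, elim conjE)
  fix I assume I: "is_ideal R I" "I \<noteq> {0}"
  define A where "A = ideal_prod R I (ideal_inv R I)"
  have IR: "I \<subseteq> R" "submod R I" using I by (auto simp: is_ideal_def)
  obtain i where i: "i \<in> I" "i \<noteq> 0" using I submod_zero[OF IR(2)] by blast
  have A: "submod R A" unfolding A_def ideal_prod_def by (rule submod_hull)
  have AR: "A \<subseteq> R"
    unfolding A_def ideal_prod_def
    by (intro hull_subset_submod submod_self) (auto simp: ideal_inv_def mult.commute)
  have prod_mem: "x * y \<in> A" if "x \<in> I" "y \<in> ideal_inv R I" for x y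
    unfolding A_def ideal_prod_def by (rule hull_inc) (use that in blast)
  have one_inv: "1 \<in> ideal_inv R I" using IR by (auto simp: ideal_inv_def)
  have "i \<in> A" using prod_mem[OF i(1) one_inv] by simp
  have "ideal_inv R A \<subseteq> R"
  proof
    fix c assume c: "c \<in> ideal_inv R A"
    have closed: "c * y \<in> ideal_inv R I" if y: "y \<in> ideal_inv R I" for y
    proof -
      have "c * (x * y) \<in> R" if "x \<in> I" for x
        using c prod_mem[OF that y] by (simp add: ideal_inv_def)
      then show ?thesis by (simp add: ideal_inv_def mult_ac)
    qed
    have "c ^ n \<in> ideal_inv R I" for n
      by (induction n) (use one_inv closed in auto)
    then have "i * c ^ n \<in> R" for n
      using i by (auto simp: ideal_inv_def mult.commute)
    then show "c \<in> R"
      using completely_integrally_closed i unfolding completely_integrally_closed_def by blast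
  qed
  then have "R \<subseteq> v_op R A"
    using ideal_inv_antimono[of "ideal_inv R A" R R] by (simp add: v_op_def ideal_inv_self)
  also have "\<dots> \<subseteq> t_op R A"
    using v_op_subset_t_op_ideal[OF A AR] \<open>i \<in> A\<close> i by blast
  finally have "R \<subseteq> t_op R A" .
  moreover have "t_op R A \<subseteq> R"
    using t_op_subset_v_op[of A] v_op_mono[OF AR, of R] by (simp add: v_op_self)
  ultimately show "t_op R (ideal_prod R I (ideal_inv R I)) = R"
    by (simp add: A_def)
qed

text \<open>
  Otherwise choose, in each of the finitely many centers, an element outside \<open>P\<close>: a product of
  powers of these elements has values at least \<open>b\<close>.
\<close>

lemma ex_center_subset_prime:
  assumes P: "prime_ideal R P"
    and b: "finite {v \<in> W. b v > 0}"
      "\<And>x. x \<in> R \<Longrightarrow> x \<noteq> 0 \<Longrightarrow> (\<And>v. v \<in> W \<Longrightarrow> b v \<le> v x) \<Longrightarrow> x \<in> P"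
  obtains v where "v \<in> W" "b v > 0" "{x \<in> R. x = 0 \<or> v x > 0} \<subseteq> P"
proof (rule ccontr)
  assume "\<not> thesis"
  note P' = prime_idealD[OF P]
  let ?B = "{v \<in> W. b v > 0}"
  have "\<exists>x. x \<in> R \<and> x \<noteq> 0 \<and> v x > 0 \<and> x \<notin> P" if "v \<in> ?B" for v
    using that \<open>\<not> thesis\<close> \<open>\<And>v. v \<in> W \<Longrightarrow> _ \<Longrightarrow> _ \<Longrightarrow> thesis\<close> P'(4) by blast
  then obtain x where x: "\<And>v. v \<in> ?B \<Longrightarrow> x v \<in> R \<and> x v \<noteq> 0 \<and> v (x v) > 0 \<and> x v \<notin> P"
    by metis
  \<comment> \<open>Each \<open>x v\<close> has value at least \<open>1\<close> under
    \<open>v\<close>, so the exponent \<open>b v\<close> reaches the required bound.\<close>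
  let ?y = "\<lambda>v. x v ^ nat (b v)"
  have y: "?y v \<in> R" "?y v \<noteq> 0" "?y v \<notin> P" if "v \<in> ?B" for v
    using x[OF that] prime_power[OF P] by auto
  have prod: "prod ?y A \<in> R \<and> prod ?y A \<noteq> 0 \<and> prod ?y A \<notin> P" if "finite A" "A \<subseteq> ?B" for A
    using that
  proof (induction A rule: finite_induct)
    case empty
    then show ?case using P' by simp
  next
    case (insert v A)
    then have "?y v \<in> R" "?y v \<noteq> 0" "?y v \<notin> P" using y[of v] by auto
    then show ?case using insert P'(5)[of "?y v" "prod ?y A"] by auto
  qed
  have "b w \<le> w (prod ?y ?B)" if w: "w \<in> W" for w
  proof (cases "b w > 0")
    case False
    then show ?thesis using val_nonneg[OF w, of "prod ?y ?B"] prod[OF b(1) order.refl] by simp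
  next
    case True
    then have wB: "w \<in> ?B" using w by simp
    have "b w \<le> int (nat (b w)) * w (x w)"
      using True x[OF wB] mult_left_mono[of 1 "w (x w)" "b w"] by simp
    also have "\<dots> = w (?y w)" using int_valuation_power[OF val[OF w]] x[OF wB] by simp
    also have "\<dots> \<le> (\<Sum>v\<in>?B. w (?y v))"
      by (rule member_le_sum) (use wB b(1) val_nonneg[OF w] y in auto)
    also have "\<dots> = w (prod ?y ?B)"
      using y by (intro int_valuation_prod[OF val[OF w] b(1), symmetric]) auto
    finally show ?thesis .
  qed
  then have "prod ?y ?B \<in> P" using b(2) prod[OF b(1) order.refl] by blast
  then show False using prod[OF b(1) order.refl] by blast
qed

text \<open>Elements whose values dominate those of \<open>a\<close> are multiples of
  \<open>a\<close>. A minimal prime of \<open>a\<close> therefore contains the center of some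
  \<open>v\<close> with \<open>v a > 0\<close>; that center is itself a prime containing
  \<open>a\<close>, so the two agree.\<close>

lemma finite_minimal_primes:
  assumes a: "a \<in> R"
  shows "finite (minimal_primes R (submod R hull {a}))"
proof (cases "a = 0")
  case True
  have "prime_ideal R {0}"
    by (auto simp: prime_ideal_def is_ideal_def submod_def) (metis one singletonD zero_neq_one)
  then have "minimal_primes R (submod R hull {a}) \<subseteq> {{0}}"
    using True prime_idealD(4) by (fastforce simp: minimal_primes_hull_iff)
  then show ?thesis using finite_subset by blast
next
  case False
  let ?c = "\<lambda>v. {x \<in> R. x = 0 \<or> v x > 0}"
  have "minimal_primes R (submod R hull {a}) \<subseteq> ?c ` {v \<in> W. v a \<noteq> 0}"
  proof
    fix P assume "P \<in> minimal_primes R (submod R hull {a})"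
    then have P: "prime_ideal R P" "a \<in> P" "\<And>Q. prime_ideal R Q \<Longrightarrow> a \<in> Q \<Longrightarrow> Q \<subseteq> P \<Longrightarrow> Q = P"
      unfolding minimal_primes_hull_iff by blast+
    note P' = prime_idealD[OF P(1)]
    have "x \<in> P" if "x \<in> R" "x \<noteq> 0" "\<And>v. v \<in> W \<Longrightarrow> v a \<le> v x" for x
    proof -
      have "x / a \<in> R"
        unfolding mem_iff[of "x / a"] using that False by (simp add: int_valuation_divide[OF val])
      then show ?thesis using P'(6)[OF _ P(2), of "x / a"] False by simp
    qed
    moreover have "finite {v \<in> W. v a > 0}"
      using finite_nonzero[OF False] by (rule rev_finite_subset) auto
    ultimately obtain v where v: "v \<in> W" "v a > 0" "?c v \<subseteq> P"
      using ex_center_subset_prime[OF P(1), of "\<lambda>v. v a"] by blast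
    note iv = val[OF v(1)]
    have "prime_ideal R (?c v)"
      unfolding prime_ideal_def is_ideal_def submod_def
    proof (intro conjI ballI impI)
      have eq: "?c v = {x \<in> R. x = 0 \<or> 1 \<le> v x}" by auto
      show "x + y \<in> ?c v" if "x \<in> ?c v" "y \<in> ?c v" for x y
        using that add int_valuation_add_ge[OF iv, of x 1 y] unfolding eq by blast
      show "r * x \<in> ?c v" if "r \<in> R" "x \<in> ?c v" for r x
        using that mult int_valuation_mult_ge[OF iv, of r 0 x 1] val_nonneg[OF v(1), of r]
        unfolding eq by auto
      have "1 \<notin> ?c v" using int_valuation_one[OF iv] by simp
      then show "?c v \<noteq> R" using one by metis
      fix x y assume "x \<in> R" "y \<in> R" "x * y \<in> ?c v"
      then show "x \<in> ?c v \<or> y \<in> ?c v"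
        using int_valuation_mult[OF iv, of x y] val_nonneg[OF v(1), of x] val_nonneg[OF v(1), of y]
        by (cases "x = 0"; cases "y = 0") auto
    qed auto
    then have "?c v = P" using P(3) v a by blast
    then show "P \<in> ?c ` {v \<in> W. v a \<noteq> 0}" using v by auto
  qed
  then show ?thesis using finite_nonzero[OF False] finite_subset by blast
qed

section \<open>Localizations of a Krull domain at maximal \<open>t\<close>-ideals\<close>

lemma divisorial_maximal_t_ideal:
  assumes M: "maximal_t_ideal R M"
  shows "v_op R M = M"
  using v_op_subset_t_op_ideal[of M] maximal_t_idealD[OF M] subset_v_op[of M R] by auto

text \<open>For \<open>a\<close> outside \<open>M\<close>, the colon ideal of all \<open>x\<close>
  with \<open>a * x \<in> M\<close> contains \<open>M\<close> and omits \<open>1\<close>. As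
  \<open>M\<close> is divisorial, the colon ideal is an inverse, hence a \<open>t\<close>-ideal, and
  maximality makes it equal to \<open>M\<close>.\<close>

lemma maximal_t_ideal_prime_ideal:
  assumes M: "maximal_t_ideal R M"
  shows "prime_ideal R M"
proof -
  note M' = maximal_t_idealD[OF M]
  have "b \<in> M" if ab: "a \<in> R" "b \<in> R" "a * b \<in> M" "a \<notin> M" for a b
  proof -
    have "ideal_inv R (insert 1 ((\<lambda>x. a * x) ` ideal_inv R M)) = {x \<in> R. a * x \<in> v_op R M}"
      by (auto simp: ideal_inv_def v_op_def mult_ac)
    then have N: "ideal_inv R (insert 1 ((\<lambda>x. a * x) ` ideal_inv R M)) = {x \<in> R. a * x \<in> M}" (is "_ = ?N")
      using divisorial_maximal_t_ideal[OF M] by simp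
    have "M \<subseteq> ?N" using M'(1,2) ab submod_mult by blast
    moreover have "1 \<notin> ?N" using ab by simp
    moreover have "t_ideal R ?N"
      using t_ideal_ideal_inv[of "insert 1 ((\<lambda>x. a * x) ` ideal_inv R M)"] M'(4,5) \<open>M \<subseteq> ?N\<close>
      unfolding N by blast
    ultimately have "?N = M"
      using M one unfolding maximal_t_ideal_def by blast
    then show ?thesis using ab by blast
  qed
  then show ?thesis using M'(1-3) one unfolding prime_ideal_def is_ideal_def by blast
qed

text \<open>
  A maximal \<open>t\<close>-ideal \<open>M\<close> is not stable under \<open>M\<^sup>-\<^sup>1\<close> because \<open>R\<close> is completely integrally closed;
  if \<open>m * c \<notin> M\<close> with \<open>m \<in> M\<close> and \<open>c \<in> M\<^sup>-\<^sup>1\<close>, then \<open>m\<close> generates the maximal ideal of \<open>R\<^sub>M\<close>.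
\<close>

lemma localization_discrete_valuation_ring_maximal_t_ideal:
  assumes M: "maximal_t_ideal R M"
  shows "discrete_valuation_ring (localization R M)"
proof -
  let ?V = "localization R M"
  have prime: "prime_ideal R M" using M by (rule maximal_t_ideal_prime_ideal)
  note M' = prime_idealD[OF prime]
  obtain z where z: "z \<in> M" "z \<noteq> 0" using maximal_t_idealD(5)[OF M] M'(4) by blast
  have "\<exists>m\<in>M. \<exists>c\<in>ideal_inv R M. c * m \<notin> M"
  proof (rule ccontr)
    assume "\<not> ?thesis"
    then have "ideal_inv R M \<subseteq> R"
      using ideal_inv_if_power_closed[OF M'(2) z] by blast
    then have "ideal_inv R R \<subseteq> v_op R M"
      unfolding v_op_def by (rule ideal_inv_antimono)
    then have "R \<subseteq> M" using divisorial_maximal_t_ideal[OF M] by (simp add: ideal_inv_self)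
    then show False using M'(3) one by blast
  qed
  then obtain m c where m: "m \<in> M" "c \<in> ideal_inv R M" "c * m \<notin> M" by blast
  have cm: "c * m \<in> R" using m by (auto simp: ideal_inv_def)
  have m0: "m \<noteq> 0" "c \<noteq> 0" using m M'(4) by auto
  have mR: "m \<in> R" using m M' by blast
  obtain S where S: "finite S" "S \<subseteq> M" "z \<in> S"
    "\<And>v x. v \<in> W \<Longrightarrow> x \<in> M \<Longrightarrow> x \<noteq> 0 \<Longrightarrow> \<exists>s\<in>S. s \<noteq> 0 \<and> v s \<le> v x"
    using ex_finite_min_values[OF M'(2) z] by blast
  define S' where "S' = S - {0}"
  \<comment> \<open>For \<open>v \<in> W\<close>, this is the minimum of \<open>v\<close> on the
    nonzero elements of \<open>M\<close>; \<open>0\<close> is removed because its value is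
    arbitrary.\<close>
  define b where "b v = Min (v ` S')" for v :: "'k \<Rightarrow> int"
  have S': "finite S'" "z \<in> S'" using S z by (auto simp: S'_def)
  have b_le: "b v \<le> v x" if v: "v \<in> W" "x \<in> M" "x \<noteq> 0" for v x
  proof -
    obtain s where "s \<in> S'" "v s \<le> v x" using S(4)[OF v] by (auto simp: S'_def)
    then show ?thesis
      using S' Min_le[of "v ` S'" "v s"] unfolding b_def by (meson finite_imageI imageI order_trans)
  qed
  \<comment> \<open>A divisorial ideal is determined by its minimal values.\<close>
  have M_if: "x \<in> M" if x: "x \<in> R" "x \<noteq> 0" "\<And>v. v \<in> W \<Longrightarrow> b v \<le> v x" for x
  proof -
    have "x * d \<in> R" if d: "d \<in> ideal_inv R M" for d
    proof (cases "d = 0")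
      case False
      have "v (x * d) \<ge> 0" if v: "v \<in> W" for v
      proof -
        have "b v \<in> v ` S'" unfolding b_def using S' by (intro Min_in) auto
        then obtain s where s: "s \<in> S'" "b v = v s" by blast
        then have "s \<in> M" "s \<noteq> 0" using S by (auto simp: S'_def)
        then have "v (d * s) \<ge> 0"
          using val_nonneg[OF v] d False by (auto simp: ideal_inv_def)
        then show ?thesis
          using x(3)[OF v] s False x(2) \<open>s \<noteq> 0\<close> by (simp add: int_valuation_mult[OF val[OF v]])
      qed
      then show ?thesis using mem_iff by blast
    qed simp
    then have "x \<in> v_op R M" by (auto simp: v_op_def ideal_inv_def)
    then show ?thesis using divisorial_maximal_t_ideal[OF M] by simp
  qed
  have "finite {v \<in> W. b v > 0}"
  proof (rule finite_subset)
    show "{v \<in> W. b v > 0} \<subseteq> {v \<in> W. v z \<noteq> 0}" using b_le[OF _ z] by fastforce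
  qed (rule finite_nonzero[OF z(2)])
  \<comment> \<open>The valuation \<open>v\<close> is positive on \<open>M\<close> and zero outside
    it. Its purpose is to bound the power of \<open>m\<close> that can divide an element.\<close>
  then obtain v where v: "v \<in> W" "b v > 0" "{x \<in> R. x = 0 \<or> v x > 0} \<subseteq> M"
    using ex_center_subset_prime[OF prime, of b] M_if by blast
  note iv = val[OF v(1)]
  have v_zero: "v s = 0" if "s \<in> R" "s \<notin> M" for s
    using that v(3) val_nonneg[OF v(1) that(1)] M'(4) by force
  have v_pos: "v x > 0" if "x \<in> M" "x \<noteq> 0" for x
    using b_le[OF v(1) that] v(2) by simp
  have v_V: "v y \<ge> 0" if y: "y \<in> ?V" "y \<noteq> 0" for y
  proof -
    obtain a s where as: "a \<in> R" "s \<in> R" "s \<notin> M" "s \<noteq> 0" "y = a / s"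
      using y(1) M'(4) by (rule localization_cases)
    then show ?thesis
      using int_valuation_divide[OF iv, of a s] v_zero val_nonneg[OF v(1), of a] y by auto
  qed
  have one_V: "1 \<in> ?V" using mem_localization[OF M'(3) one] .
  have RV: "x \<in> ?V" if "x \<in> R" for x using mem_localization[OF M'(3) that] .
  have notin: "s * t \<notin> M" if "s \<in> R" "s \<notin> M" "t \<in> R" "t \<notin> M" for s t
    using M'(5) that by blast
  have diff_V: "x - y \<in> ?V" if xy: "x \<in> ?V" "y \<in> ?V" for x y
  proof -
    obtain a s where as: "a \<in> R" "s \<in> R" "s \<notin> M" "s \<noteq> 0" "x = a / s"
      using xy(1) M'(4) by (rule localization_cases)
    obtain b t where bt: "b \<in> R" "t \<in> R" "t \<notin> M" "t \<noteq> 0" "y = b / t"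
      using xy(2) M'(4) by (rule localization_cases)
    have "x - y = (a * t - b * s) / (s * t)" using as bt by (simp add: field_simps)
    then show ?thesis
      using mem_localizationI[of "a * t - b * s" "s * t" M] notin as bt diff mult by simp
  qed
  have mult_V: "x * y \<in> ?V" if xy: "x \<in> ?V" "y \<in> ?V" for x y
  proof -
    obtain a s where as: "a \<in> R" "s \<in> R" "s \<notin> M" "s \<noteq> 0" "x = a / s"
      using xy(1) M'(4) by (rule localization_cases)
    obtain b t where bt: "b \<in> R" "t \<in> R" "t \<notin> M" "t \<noteq> 0" "y = b / t"
      using xy(2) M'(4) by (rule localization_cases)
    then show ?thesis
      using mem_localizationI[of "a * b" "s * t" M] notin as mult by simp
  qed
  have rep_R: "\<exists>k::int. x / m powi k \<in> ?V \<and> inverse (x / m powi k) \<in> ?V" if x: "x \<in> R" "x \<noteq> 0" for x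
  proof -
    have bound: "n \<le> nat (v x)" if "x / m ^ n \<in> ?V" for n
    proof -
      have "0 \<le> v x - int n * v m"
        using v_V[OF that] x m0 int_valuation_divide[OF iv, of x "m ^ n"] int_valuation_power[OF iv, of m n]
        by simp
      moreover have "int n * 1 \<le> int n * v m" using v_pos[OF m(1) m0(1)] by (intro mult_left_mono) auto
      ultimately show ?thesis by simp
    qed
    obtain n where n: "x / m ^ n \<in> ?V" "\<And>k. x / m ^ k \<in> ?V \<Longrightarrow> k \<le> n"
      using ex_has_greatest_nat[of "\<lambda>n. x / m ^ n \<in> ?V" 0 "\<lambda>n. n" "Suc (nat (v x))"] bound RV[OF x(1)]
      by (auto simp: less_Suc_eq_le)
    obtain a s where as: "a \<in> R" "s \<in> R" "s \<notin> M" "s \<noteq> 0" "x / m ^ n = a / s"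
      using n(1) M'(4) by (rule localization_cases)
    have "a \<notin> M"
    proof
      assume a: "a \<in> M"
      \<comment> \<open>Division by \<open>m\<close> becomes legitimate after multiplying by
        \<open>c\<close>: the numerator \<open>c * a\<close> is in \<open>R\<close>, and the
        denominator \<open>s * (c * m)\<close> avoids \<open>M\<close>. This contradicts the choice
        of \<open>n\<close> as greatest.\<close>
      have "c * a / (s * (c * m)) \<in> ?V"
        using a m(2,3) cm as notin by (intro mem_localizationI) (auto simp: ideal_inv_def)
      moreover have "x / m ^ Suc n = (x / m ^ n) / m" by simp
      then have "x / m ^ Suc n = c * a / (s * (c * m))" using m0 as(5) by simp
      ultimately have "x / m ^ Suc n \<in> ?V" by (simp only:)
      then show False using n(2)[of "Suc n"] by simp
    qed
    then have "inverse (x / m ^ n) \<in> ?V" using as mem_localizationI[of s a M] by simp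
    then show ?thesis using n(1) by (intro exI[of _ "int n"]) simp
  qed
  show ?thesis
  proof (rule discrete_valuation_ringI)
    show "m \<in> ?V" using RV[OF mR] .
    show "inverse m \<notin> ?V" using inverse_notin_localization[OF M'(1) m(1) m0(1)] .
    fix x :: 'k assume "x \<noteq> 0"
    obtain a b where ab: "a \<in> R" "b \<in> R" "b \<noteq> 0" "x = a / b" by (rule quotient_rep)
    then have "a \<noteq> 0" using \<open>x \<noteq> 0\<close> by auto
    obtain k where k: "a / m powi k \<in> ?V" "inverse (a / m powi k) \<in> ?V"
      using rep_R[OF ab(1) \<open>a \<noteq> 0\<close>] by blast
    obtain l where l: "b / m powi l \<in> ?V" "inverse (b / m powi l) \<in> ?V"
      using rep_R[OF ab(2,3)] by blast
    have "x / m powi (k - l) = (a / m powi k) * inverse (b / m powi l)"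
      using ab m0 by (simp add: power_int_diff)
    moreover have "inverse (x / m powi (k - l)) = inverse (a / m powi k) * (b / m powi l)"
      using ab m0 by (simp add: power_int_diff)
    ultimately show "\<exists>k::int. x / m powi k \<in> ?V \<and> inverse (x / m powi k) \<in> ?V"
      using mult_V[OF k(1) l(2)] mult_V[OF k(2) l(1)] by (intro exI[of _ "k - l"]) (simp only:)
  qed (use one_V diff_V mult_V in auto)
qed

lemma krull_like_PVMD: "krull_like_PVMD R"
  using PVMD finite_minimal_primes localization_discrete_valuation_ring_maximal_t_ideal
    discrete_valuation_ring_strongly_discrete
  by (auto simp: krull_like_PVMD_def)

end

subsection \<open>Prime elements of Euclidean subrings\<close>

text \<open>Division is stated for all field elements, with \<open>\<phi>\<close> negative on the
  remainder. For \<open>h = x / d\<close>, multiplying by \<open>d\<close> recovers the usual form: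
  the remainder has smaller value than \<open>d\<close>.\<close>

locale euclidean_subring =
  fixes S :: "'l::field set" and \<phi> :: "'l \<Rightarrow> int"
  assumes one_mem: "1 \<in> S"
    and diff_mem: "x \<in> S \<Longrightarrow> y \<in> S \<Longrightarrow> x - y \<in> S"
    and mult_mem: "x \<in> S \<Longrightarrow> y \<in> S \<Longrightarrow> x * y \<in> S"
    and phi_mult: "x \<noteq> 0 \<Longrightarrow> y \<noteq> 0 \<Longrightarrow> \<phi> (x * y) = \<phi> x + \<phi> y"
    and phi_nonneg: "x \<in> S \<Longrightarrow> x \<noteq> 0 \<Longrightarrow> \<phi> x \<ge> 0"
    and division: "\<exists>q\<in>S. h = q \<or> \<phi> (h - q) < 0"
begin

lemma zero_mem: "0 \<in> S"
  using diff_mem[OF one_mem one_mem] by simp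

lemma add_mem: "x \<in> S \<Longrightarrow> y \<in> S \<Longrightarrow> x + y \<in> S"
  using diff_mem[of x "0 - y"] diff_mem[OF zero_mem, of y] by simp

lemma power_mem: "x \<in> S \<Longrightarrow> x ^ n \<in> S"
  by (induction n) (auto simp: one_mem mult_mem)

lemma phi_one: "\<phi> 1 = 0"
  using phi_mult[of 1 1] by simp

lemma phi_power: "x \<noteq> 0 \<Longrightarrow> \<phi> (x ^ n) = int n * \<phi> x"
  by (induction n) (auto simp: phi_one phi_mult distrib_right)

lemma inverse_mem:
  assumes x: "x \<in> S" "x \<noteq> 0" "\<phi> x = 0"
  shows "inverse x \<in> S"
proof -
  obtain q where q: "q \<in> S" "inverse x = q \<or> \<phi> (inverse x - q) < 0"
    using division by blast
  have "inverse x = q"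
  proof (rule ccontr)
    assume ne: "inverse x \<noteq> q"
    then have "\<phi> (x * (inverse x - q)) < 0"
      using q x by (subst phi_mult) auto
    moreover have "x * (inverse x - q) \<in> S"
      using x q one_mem diff_mem mult_mem by (auto simp: right_diff_distrib)
    ultimately show False using phi_nonneg[of "x * (inverse x - q)"] ne x by auto
  qed
  then show ?thesis using q by simp
qed

text \<open>A nonzero combination of least value divides every other one, since a remainder would
  again be a combination, of smaller value.\<close>

lemma bezout:
  assumes fg: "f \<in> S" "g \<in> S" "f \<noteq> 0"
  obtains a b where "a \<in> S" "b \<in> S" "a * f + b * g \<noteq> 0"
    "f / (a * f + b * g) \<in> S" "g / (a * f + b * g) \<in> S"
proof -
  define I where "I = {a * f + b * g | a b. a \<in> S \<and> b \<in> S}"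
  have I_S: "x \<in> S" if "x \<in> I" for x
    using that fg add_mem mult_mem by (auto simp: I_def)
  have f: "f \<in> I" unfolding I_def using one_mem zero_mem by force
  have g: "g \<in> I" unfolding I_def using one_mem zero_mem by force
  have diff: "x - q * y \<in> I" if xy: "x \<in> I" "y \<in> I" and q: "q \<in> S" for x y q
  proof -
    obtain a b c d where "x = a * f + b * g" "y = c * f + d * g" "a \<in> S" "b \<in> S" "c \<in> S" "d \<in> S"
      using xy by (auto simp: I_def)
    moreover from this have "x - q * y = (a - q * c) * f + (b - q * d) * g"
      by (simp add: algebra_simps)
    ultimately show ?thesis unfolding I_def using q diff_mem mult_mem by blast
  qed
  obtain d where d: "d \<in> I" "d \<noteq> 0" "\<And>x. x \<in> I \<and> x \<noteq> 0 \<Longrightarrow> nat (\<phi> d) \<le> nat (\<phi> x)"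
    using ex_has_least_nat[of "\<lambda>x. x \<in> I \<and> x \<noteq> 0" f "\<lambda>x. nat (\<phi> x)"] f fg by blast
  have dvd: "x / d \<in> S" if x: "x \<in> I" for x
  proof -
    obtain q where q: "q \<in> S" "x / d = q \<or> \<phi> (x / d - q) < 0" using division by blast
    have "x / d = q"
    proof (rule ccontr)
      assume ne: "x / d \<noteq> q"
      let ?r = "x - q * d"
      have r: "?r = d * (x / d - q)" using d(2) by (simp add: field_simps)
      have "?r \<in> I" using diff[OF x d(1) q(1)] .
      moreover have "?r \<noteq> 0" using r d(2) ne by auto
      moreover have "\<phi> ?r < \<phi> d" unfolding r using phi_mult[of d "x / d - q"] q(2) ne d(2) by auto
      ultimately show False using d(3)[of ?r] phi_nonneg[OF I_S] by fastforce
    qed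
    then show ?thesis using q by simp
  qed
  obtain a b where "a \<in> S" "b \<in> S" "d = a * f + b * g" using d(1) by (auto simp: I_def)
  then show ?thesis using that d(2) dvd[OF f] dvd[OF g] by simp
qed

text \<open>By \<open>inverse_mem\<close>, elements of value \<open>0\<close> are units, so the last
  clause is ordinary irreducibility.\<close>

definition irred :: "'l \<Rightarrow> bool" where
  "irred p \<longleftrightarrow> p \<in> S \<and> p \<noteq> 0 \<and> \<phi> p > 0 \<and> (\<forall>a\<in>S. \<forall>b\<in>S. p = a * b \<longrightarrow> \<phi> a = 0 \<or> \<phi> b = 0)"

lemma irredD:
  assumes "irred p"
  shows "p \<in> S" "p \<noteq> 0" "\<phi> p > 0" "\<And>a b. a \<in> S \<Longrightarrow> b \<in> S \<Longrightarrow> p = a * b \<Longrightarrow> \<phi> a = 0 \<or> \<phi> b = 0"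
  using assms by (auto simp: irred_def)

text \<open>A greatest common divisor \<open>d\<close> of \<open>p\<close> and \<open>f\<close> is a
  unit or an associate of \<open>p\<close>. The latter would make \<open>p\<close> divide
  \<open>f\<close>; in the former case the Bezout identity multiplied by \<open>g\<close> exhibits
  the quotient \<open>g / p\<close>.\<close>

lemma irred_prime:
  assumes p: "irred p" and f: "f \<in> S" and g: "g \<in> S" and dvd: "f * g / p \<in> S" and not: "f / p \<notin> S"
  shows "g / p \<in> S"
proof -
  note p' = irredD[OF p]
  obtain a b where ab: "a \<in> S" "b \<in> S" "a * p + b * f \<noteq> 0"
    "p / (a * p + b * f) \<in> S" "f / (a * p + b * f) \<in> S"
    using bezout[OF p'(1) f p'(2)] by blast
  define d where "d = a * p + b * f"
  have d: "d \<in> S" "d \<noteq> 0" "p / d \<in> S" "f / d \<in> S"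
    using ab p'(1) f add_mem mult_mem by (auto simp: d_def)
  have "\<phi> d = 0 \<or> \<phi> (p / d) = 0" using p'(4)[OF d(1,3)] d(2) by simp
  moreover have "\<phi> (p / d) \<noteq> 0"
  proof
    assume "\<phi> (p / d) = 0"
    then have "inverse (p / d) \<in> S" using inverse_mem[OF d(3)] d(2) p'(2) by simp
    then have "f / d * inverse (p / d) \<in> S" using d mult_mem by blast
    moreover have "f / d * inverse (p / d) = f / p" using d(2) by (simp add: field_simps)
    ultimately show False using not by (simp only:)
  qed
  ultimately have "inverse d \<in> S" using inverse_mem d by blast
  then have "inverse d * (a * g + b * (f * g / p)) \<in> S"
    using ab(1,2) g dvd by (intro mult_mem add_mem)
  moreover have "inverse d * (a * g + b * (f * g / p)) = g / p"
  proof -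
    have "a * g + b * (f * g / p) = d * g / p" using p'(2) by (simp add: d_def field_simps)
    then show ?thesis using d(2) by (simp add: field_simps)
  qed
  ultimately show ?thesis by (simp only:)
qed

lemma ex_irred_divisor:
  assumes g: "g \<in> S" "g \<noteq> 0" "\<phi> g > 0"
  obtains p where "irred p" "g / p \<in> S"
proof -
  let ?D = "\<lambda>d. d \<in> S \<and> d \<noteq> 0 \<and> \<phi> d > 0 \<and> g / d \<in> S"
  have "?D g" using g one_mem by simp
  then obtain p where p: "?D p" "\<And>d. ?D d \<Longrightarrow> nat (\<phi> p) \<le> nat (\<phi> d)"
    using ex_has_least_nat[of ?D g "\<lambda>x. nat (\<phi> x)"] by blast
  have "\<phi> a = 0 \<or> \<phi> b = 0" if ab: "a \<in> S" "b \<in> S" "p = a * b" for a b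
  proof (rule ccontr)
    assume not: "\<not> ?thesis"
    have ab0: "a \<noteq> 0" "b \<noteq> 0" using p ab by auto
    then have pos: "\<phi> a > 0" "\<phi> b > 0" using not phi_nonneg ab by (auto simp: order.strict_iff_order)
    have "b * (g / p) \<in> S" using p ab mult_mem by blast
    then have "g / a \<in> S" using ab ab0 by simp
    then have "nat (\<phi> p) \<le> nat (\<phi> a)" using p(2)[of a] ab ab0 pos by simp
    then show False using pos phi_mult[OF ab0] ab by simp
  qed
  then have "irred p" using p by (auto simp: irred_def)
  then show ?thesis using that p by blast
qed

section \<open>Multiplicities of irreducible elements\<close>

definition mult_order :: "'l \<Rightarrow> 'l \<Rightarrow> nat" where
  "mult_order p f = (GREATEST n. f / p ^ n \<in> S)"

lemma mult_order:
  assumes p: "irred p" and f: "f \<in> S" "f \<noteq> 0"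
  shows "f / p ^ mult_order p f \<in> S" "f / p ^ Suc (mult_order p f) \<notin> S"
    "f / p ^ n \<in> S \<Longrightarrow> n \<le> mult_order p f"
proof -
  note p' = irredD[OF p]
  have bound: "n \<le> nat (\<phi> f)" if "f / p ^ n \<in> S" for n
  proof -
    have "\<phi> f = \<phi> (f / p ^ n) + int n * \<phi> p"
      using phi_mult[of "f / p ^ n" "p ^ n"] phi_power[OF p'(2), of n] f p'(2) by simp
    moreover have "\<phi> (f / p ^ n) \<ge> 0" using phi_nonneg that f p'(2) by simp
    moreover have "int n * 1 \<le> int n * \<phi> p" using p'(3) by (intro mult_left_mono) auto
    ultimately show ?thesis by simp
  qed
  have "f / p ^ 0 \<in> S" using f by simp
  then show 1: "f / p ^ mult_order p f \<in> S"
    unfolding mult_order_def by (rule GreatestI_nat) (use bound in blast)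
  show 2: "n \<le> mult_order p f" if "f / p ^ n \<in> S" for n
    unfolding mult_order_def by (rule Greatest_le_nat[where P = "\<lambda>n. f / p ^ n \<in> S", OF that]) (use bound in blast)
  show "f / p ^ Suc (mult_order p f) \<notin> S" using 2[of "Suc (mult_order p f)"] by auto
qed

lemma div_power_mem:
  assumes "p \<in> S" "p \<noteq> 0" "f / p ^ n \<in> S" "m \<le> n"
  shows "f / p ^ m \<in> S"
proof -
  have "p ^ (n - m) * (f / p ^ n) \<in> S" using assms power_mem mult_mem by blast
  moreover have "p ^ n = p ^ m * p ^ (n - m)" using assms(4) by (simp flip: power_add)
  ultimately show ?thesis using assms(2) by simp
qed

lemma mult_order_ge_iff:
  assumes p: "irred p" and f: "f \<in> S" "f \<noteq> 0"
  shows "n \<le> mult_order p f \<longleftrightarrow> f / p ^ n \<in> S"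
  using mult_order[OF assms] div_power_mem[OF irredD(1,2)[OF p]] by blast

lemma mult_order_mult:
  assumes p: "irred p" and f: "f \<in> S" "f \<noteq> 0" and g: "g \<in> S" "g \<noteq> 0"
  shows "mult_order p (f * g) = mult_order p f + mult_order p g"
proof -
  note p' = irredD[OF p]
  let ?m = "mult_order p f" and ?n = "mult_order p g"
  have fg: "f * g \<in> S" "f * g \<noteq> 0" using f g mult_mem by auto
  have eq: "f * g / p ^ (?m + ?n) = (f / p ^ ?m) * (g / p ^ ?n)" by (simp add: power_add)
  then have "?m + ?n \<le> mult_order p (f * g)"
    using mult_mem[OF mult_order(1)[OF p f] mult_order(1)[OF p g]]
    unfolding mult_order_ge_iff[OF p fg] by (simp only: eq)
  moreover have "\<not> Suc (?m + ?n) \<le> mult_order p (f * g)"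
  proof
    assume "Suc (?m + ?n) \<le> mult_order p (f * g)"
    then have "f * g / p ^ Suc (?m + ?n) \<in> S" using mult_order_ge_iff[OF p fg] by blast
    then have "(f / p ^ ?m) * (g / p ^ ?n) / p \<in> S" by (simp add: power_add mult_ac)
    then have "g / p ^ ?n / p \<in> S"
      using mult_order(2)[OF p f]
      by (intro irred_prime[OF p mult_order(1)[OF p f] mult_order(1)[OF p g]]) (auto simp: mult_ac)
    then show False using mult_order(2)[OF p g] by (simp add: mult_ac)
  qed
  ultimately show ?thesis by simp
qed

lemma mult_order_add:
  assumes p: "irred p" and f: "f \<in> S" "f \<noteq> 0" and g: "g \<in> S" "g \<noteq> 0" and fg: "f + g \<noteq> 0"
  shows "min (mult_order p f) (mult_order p g) \<le> mult_order p (f + g)"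
proof -
  let ?k = "min (mult_order p f) (mult_order p g)"
  have "f / p ^ ?k \<in> S" "g / p ^ ?k \<in> S"
    using mult_order_ge_iff[OF p f, of ?k] mult_order_ge_iff[OF p g, of ?k] by auto
  then have "(f + g) / p ^ ?k \<in> S" using add_mem by (simp add: add_divide_distrib)
  then show ?thesis using mult_order_ge_iff[OF p add_mem[OF f(1) g(1)] fg] by blast
qed

lemma mult_order_pos_iff:
  assumes "irred p" "f \<in> S" "f \<noteq> 0"
  shows "mult_order p f > 0 \<longleftrightarrow> f / p \<in> S"
  using mult_order_ge_iff[OF assms, of 1] by auto

text \<open>Associated irreducibles give the same order function. Primes are therefore identified
  with these functions, and no representatives have to be chosen.\<close>

lemma mult_order_eq_if_divides:
  assumes p: "irred p" and q: "irred q" and dvd: "q / p \<in> S"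
  shows "mult_order p = mult_order q"
proof -
  note p' = irredD[OF p] and q' = irredD[OF q]
  have "\<phi> p = 0 \<or> \<phi> (q / p) = 0" using q'(4)[OF p'(1) dvd] p'(2) by simp
  then have "inverse (q / p) \<in> S" using p'(3) inverse_mem[OF dvd] p'(2) q'(2) by simp
  then have inv: "p / q \<in> S" by simp
  have "f / p ^ n \<in> S \<longleftrightarrow> f / q ^ n \<in> S" for f n
  proof
    assume "f / p ^ n \<in> S"
    then have "(p / q) ^ n * (f / p ^ n) \<in> S" using power_mem[OF inv] mult_mem by blast
    then show "f / q ^ n \<in> S" using p'(2) by (simp add: power_divide)
  next
    assume "f / q ^ n \<in> S"
    then have "(q / p) ^ n * (f / q ^ n) \<in> S" using power_mem[OF dvd] mult_mem by blast
    then show "f / p ^ n \<in> S" using q'(2) by (simp add: power_divide)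
  qed
  then show ?thesis unfolding mult_order_def by presburger
qed

lemma phi_div_less:
  assumes "irred p" "f \<in> S" "f \<noteq> 0" "f / p \<in> S"
  shows "nat (\<phi> (f / p)) < nat (\<phi> f)"
proof -
  have "\<phi> f = \<phi> p + \<phi> (f / p)" using phi_mult[of p "f / p"] irredD[OF assms(1)] assms by simp
  moreover have "\<phi> (f / p) \<ge> 0" using phi_nonneg[OF assms(4)] irredD[OF assms(1)] assms by simp
  ultimately show ?thesis using irredD(3)[OF assms(1)] by simp
qed

text \<open>Splitting off one irreducible \<open>q\<close> lowers \<open>\<phi>\<close> and removes
  at most the single function \<open>mult_order q\<close>. Functions are counted because an
  irreducible may have infinitely many associates.\<close>

lemma finite_mult_orders:
  assumes "f \<in> S" "f \<noteq> 0"
  shows "finite {mult_order p | p. irred p \<and> mult_order p f \<noteq> 0}"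
  using assms
proof (induction "nat (\<phi> f)" arbitrary: f rule: less_induct)
  case less
  show ?case
  proof (cases "\<phi> f = 0")
    case True
    then have "\<not> (irred p \<and> mult_order p f \<noteq> 0)" for p
      using phi_div_less[of p f] mult_order_pos_iff[of p f] less.prems by auto
    then have "{mult_order p | p. irred p \<and> mult_order p f \<noteq> 0} = {}" by blast
    then show ?thesis by (simp only: finite.emptyI)
  next
    case False
    then obtain q where q: "irred q" "f / q \<in> S"
      using ex_irred_divisor less.prems phi_nonneg by (metis order_less_le)
    have q0: "q \<noteq> 0" using irredD[OF q(1)] by simp
    have "finite {mult_order p | p. irred p \<and> mult_order p (f / q) \<noteq> 0}"
      using less.hyps[OF phi_div_less[OF q(1) less.prems q(2)] q(2)] less.prems q0 by simp
    moreover have "{mult_order p | p. irred p \<and> mult_order p f \<noteq> 0} \<subseteq>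
        insert (mult_order q) {mult_order p | p. irred p \<and> mult_order p (f / q) \<noteq> 0}"
    proof clarify
      fix p assume p: "irred p" "mult_order p f > 0" "mult_order p \<noteq> mult_order q"
      have "mult_order p f = mult_order p q + mult_order p (f / q)"
        using mult_order_mult[OF p(1) irredD(1,2)[OF q(1)] q(2)] q0 less.prems by simp
      moreover have "mult_order p q = 0"
        using mult_order_pos_iff[OF p(1) irredD(1,2)[OF q(1)]] mult_order_eq_if_divides[OF p(1) q(1)] p(3)
        by auto
      ultimately have "mult_order p (f / q) \<noteq> 0" using p(2) by simp
      then show "\<exists>pa. mult_order p = mult_order pa \<and> irred pa \<and> mult_order pa (f / q) \<noteq> 0"
        using p(1) by blast
    qed
    ultimately show ?thesis using finite_subset by blast
  qed
qed

text \<open>Induction on the value of \<open>g\<close>: an irreducible factor of \<open>g\<close>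
  also divides \<open>f\<close> and is cancelled from both, until \<open>g\<close> is a
  unit.\<close>

lemma divide_mem_if_mult_order_le:
  assumes "f \<in> S" "f \<noteq> 0" "g \<in> S" "g \<noteq> 0" "\<And>p. irred p \<Longrightarrow> mult_order p g \<le> mult_order p f"
  shows "f / g \<in> S"
  using assms
proof (induction "nat (\<phi> g)" arbitrary: f g rule: less_induct)
  case less
  show ?case
  proof (cases "\<phi> g = 0")
    case True
    then have "f * inverse g \<in> S" using inverse_mem mult_mem less.prems by blast
    then show ?thesis by (simp add: divide_inverse)
  next
    case False
    then obtain q where q: "irred q" "g / q \<in> S"
      using ex_irred_divisor less.prems phi_nonneg by (metis order_less_le)
    have q0: "q \<noteq> 0" using irredD[OF q(1)] by simp
    have fq: "f / q \<in> S"
      using less.prems(5)[OF q(1)] q(2) mult_order_pos_iff[OF q(1) less.prems(1,2)]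
        mult_order_pos_iff[OF q(1) less.prems(3,4)] by linarith
    have "mult_order p (g / q) \<le> mult_order p (f / q)" if p: "irred p" for p
    proof -
      have "mult_order p g = mult_order p q + mult_order p (g / q)"
        using mult_order_mult[OF p irredD(1,2)[OF q(1)] q(2)] q0 less.prems by simp
      moreover have "mult_order p f = mult_order p q + mult_order p (f / q)"
        using mult_order_mult[OF p irredD(1,2)[OF q(1)] fq] q0 less.prems by simp
      ultimately show ?thesis using less.prems(5)[OF p] by simp
    qed
    then have "f / q / (g / q) \<in> S"
      using less.hyps[OF phi_div_less[OF q(1) less.prems(3,4) q(2)] fq _ q(2)] less.prems q0 by simp
    then show ?thesis using q0 by simp
  qed
qed

end

subsection \<open>The Krull valuations of a power series ring\<close>

definition fract_val :: "('b::idom \<Rightarrow> int) \<Rightarrow> 'b fract \<Rightarrow> int" where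
  "fract_val n x = (SOME k. \<exists>f g. f \<noteq> 0 \<and> g \<noteq> 0 \<and> x = to_fract f / to_fract g \<and> k = n f - n g)"

lemma fract_val_eq:
  assumes n: "\<And>f g. f \<noteq> 0 \<Longrightarrow> g \<noteq> 0 \<Longrightarrow> n (f * g) = n f + n g" and fg: "f \<noteq> 0" "g \<noteq> 0"
  shows "fract_val n (to_fract f / to_fract g) = n f - n g"
  unfolding fract_val_def
proof (rule someI2_ex)
  show "\<exists>k f' g'. f' \<noteq> 0 \<and> g' \<noteq> 0 \<and> to_fract f / to_fract g = to_fract f' / to_fract g' \<and> k = n f' - n g'"
    using fg by blast
  fix k assume "\<exists>f' g'. f' \<noteq> 0 \<and> g' \<noteq> 0 \<and> to_fract f / to_fract g = to_fract f' / to_fract g' \<and> k = n f' - n g'"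
  then obtain f' g' where *: "f' \<noteq> 0" "g' \<noteq> 0" "to_fract f / to_fract g = to_fract f' / to_fract g'"
    "k = n f' - n g'" by blast
  then have "to_fract (f * g') = to_fract (f' * g)"
    unfolding to_fract_mult using fg by (simp add: frac_eq_eq)
  then have "f * g' = f' * g" by (simp only: to_fract_eq_iff)
  then have "n f + n g' = n f' + n g" using n fg * by metis
  then show "k = n f - n g" using * by simp
qed

text \<open>This confines later work to ring elements. The hypothesis \<open>dvd\<close> is what
  makes the intersection of the valuation rings no larger than the domain.\<close>

lemma fract_krull_valuations:
  fixes N :: "('b::idom \<Rightarrow> int) set"
  assumes mult: "\<And>n f g. n \<in> N \<Longrightarrow> f \<noteq> 0 \<Longrightarrow> g \<noteq> 0 \<Longrightarrow> n (f * g) = n f + n g"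
    and add: "\<And>n f g. n \<in> N \<Longrightarrow> f \<noteq> 0 \<Longrightarrow> g \<noteq> 0 \<Longrightarrow> f + g \<noteq> 0 \<Longrightarrow> n (f + g) \<ge> min (n f) (n g)"
    and nonneg: "\<And>n f. n \<in> N \<Longrightarrow> f \<noteq> 0 \<Longrightarrow> n f \<ge> 0"
    and fin: "\<And>f. f \<noteq> 0 \<Longrightarrow> finite {n \<in> N. n f \<noteq> 0}"
    and dvd: "\<And>f g. f \<noteq> 0 \<Longrightarrow> g \<noteq> 0 \<Longrightarrow> (\<And>n. n \<in> N \<Longrightarrow> n g \<le> n f) \<Longrightarrow> g dvd f"
  shows "krull_valuations (dom_of TYPE('b)) (fract_val ` N)"
  unfolding krull_valuations_def
proof (intro conjI ballI allI impI)
  have ev: "fract_val n (to_fract f / to_fract g) = n f - n g" if "n \<in> N" "f \<noteq> 0" "g \<noteq> 0" for n f g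
    using fract_val_eq[of n f g] mult that by blast
  show "int_valuation v" if v: "v \<in> fract_val ` N" for v
    unfolding int_valuation_def
  proof (intro conjI allI impI)
    obtain n where n: "n \<in> N" "v = fract_val n" using v by blast
    fix x y :: "'b fract"
    obtain a b where ab: "b \<noteq> 0" "x = to_fract a / to_fract b" by (rule fract_cases_quotient)
    obtain c d where cd: "d \<noteq> 0" "y = to_fract c / to_fract d" by (rule fract_cases_quotient)
    have prod: "x * y = to_fract (a * c) / to_fract (b * d)"
      using ab cd by (simp only: to_fract_mult times_divide_times_eq)
    have sum: "x + y = to_fract (a * d + c * b) / to_fract (b * d)"
      using ab cd by (simp add: add_frac_eq)
    show "v (x * y) = v x + v y" if "x \<noteq> 0 \<and> y \<noteq> 0"
    proof -
      have "a \<noteq> 0" "c \<noteq> 0" using that ab cd by auto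
      then show ?thesis
        unfolding prod n(2) using ab cd n(1) by (simp add: ev mult del: to_fract_mult)
    qed
    show "min (v x) (v y) \<le> v (x + y)" if "x \<noteq> 0 \<and> y \<noteq> 0 \<and> x + y \<noteq> 0"
    proof -
      have ac: "a \<noteq> 0" "c \<noteq> 0" using that ab cd by auto
      have s0: "a * d + c * b \<noteq> 0"
      proof
        assume "a * d + c * b = 0"
        then have "x + y = 0" unfolding sum by (simp only: to_fract_0 div_0)
        then show False using that by simp
      qed
      have "v (x + y) = n (a * d + c * b) - n (b * d)"
        unfolding n(2) sum using s0 ab(1) cd(1) by (intro ev[OF n(1)]) auto
      moreover have "n (a * d + c * b) \<ge> min (n (a * d)) (n (c * b))"
        using add[OF n(1) _ _ s0] ac ab(1) cd(1) by simp
      ultimately show ?thesis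
        using ab cd ac n by (simp add: ev mult)
    qed
  qed
  show "x \<in> dom_of TYPE('b) \<longleftrightarrow> x = 0 \<or> (\<forall>v\<in>fract_val ` N. 0 \<le> v x)" for x
  proof
    assume "x \<in> dom_of TYPE('b)"
    then obtain f where f: "x = to_fract f" by (auto simp: dom_of_iff)
    have "0 \<le> fract_val n x" if "n \<in> N" "x \<noteq> 0" for n
    proof -
      have "f \<noteq> 0" using that f by auto
      moreover have "n 1 = 0" using mult[OF that(1), of 1 1] by simp
      ultimately show ?thesis using ev[OF that(1), of f 1] nonneg[OF that(1), of f] f by simp
    qed
    then show "x = 0 \<or> (\<forall>v\<in>fract_val ` N. 0 \<le> v x)" by blast
  next
    assume x: "x = 0 \<or> (\<forall>v\<in>fract_val ` N. 0 \<le> v x)"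
    obtain f g where fg: "g \<noteq> 0" "x = to_fract f / to_fract g" by (rule fract_cases_quotient)
    have "g dvd f"
    proof (cases "f = 0")
      case False
      then have "\<forall>n\<in>N. 0 \<le> fract_val n x" using x fg by auto
      then show ?thesis using fg False by (intro dvd) (auto simp: ev)
    qed simp
    then obtain h where "f = g * h" by (rule dvdE)
    then have "x = to_fract h" using fg by simp
    then show "x \<in> dom_of TYPE('b)" by simp
  qed
  show "finite {v \<in> fract_val ` N. v x \<noteq> 0}" if "x \<noteq> 0" for x
  proof -
    obtain f g where fg: "g \<noteq> 0" "x = to_fract f / to_fract g" by (rule fract_cases_quotient)
    then have "f \<noteq> 0" using that by auto
    have "{v \<in> fract_val ` N. v x \<noteq> 0} \<subseteq> fract_val ` ({n \<in> N. n f \<noteq> 0} \<union> {n \<in> N. n g \<noteq> 0})"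
      using ev fg \<open>f \<noteq> 0\<close> by fastforce
    then show ?thesis
      using fin fg(1) \<open>f \<noteq> 0\<close> by (meson finite_UnI finite_imageI finite_subset)
  qed
qed

section \<open>Laurent series over a valuation ring\<close>

unbundle fps_syntax

definition val_laurent :: "('k::field \<Rightarrow> int) \<Rightarrow> 'k fls set" where
  "val_laurent v = {f. \<forall>n. f $$ n = 0 \<or> v (f $$ n) \<ge> 0}"

text \<open>On V((X)) value \<open>0\<close> means invertible. In V[[X]] this would fail for
  \<open>X\<close>, whose value is \<open>0\<close>; hence Laurent series.\<close>

definition lead_val :: "('k::field \<Rightarrow> int) \<Rightarrow> 'k fls \<Rightarrow> int" where
  "lead_val v f = v (f $$ fls_subdegree f)"

text \<open>Division with remainder is truncation: \<open>q\<close> is the part of \<open>h\<close>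
  before its first coefficient outside the valuation ring, and that coefficient leads the
  remainder.\<close>

lemma euclidean_subring_val_laurent:
  fixes v :: "'k::field \<Rightarrow> int"
  assumes v: "int_valuation v"
  shows "euclidean_subring (val_laurent v) (lead_val v)"
proof
  let ?V = "\<lambda>x. x = 0 \<or> v x \<ge> 0"
  show "1 \<in> val_laurent v"
    using int_valuation_one[OF v] by (auto simp: val_laurent_def)
  show "x - y \<in> val_laurent v" if "x \<in> val_laurent v" "y \<in> val_laurent v" for x y
    using that int_valuation_diff_ge[OF v, of _ 0] unfolding val_laurent_def by simp
  show "x * y \<in> val_laurent v" if xy: "x \<in> val_laurent v" "y \<in> val_laurent v" for x y
  proof -
    have sum: "?V (\<Sum>i\<in>I. g i)" if "finite I" "\<And>i. i \<in> I \<Longrightarrow> ?V (g i)" for I :: "int set" and g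
      using that
    proof (induction I rule: finite_induct)
      case (insert i I)
      then show ?case using int_valuation_add_ge[OF v, of "g i" 0 "sum g I"] by simp
    qed simp
    have "?V ((x * y) $$ n)" for n
      unfolding fls_times_nth(2)
      by (rule sum) (use xy int_valuation_mult_ge[OF v, of _ 0 _ 0] in \<open>auto simp: val_laurent_def\<close>)
    then show ?thesis by (simp add: val_laurent_def)
  qed
  show "lead_val v (x * y) = lead_val v x + lead_val v y" if "x \<noteq> 0" "y \<noteq> 0" for x y
    using that int_valuation_mult[OF v] by (simp add: lead_val_def)
  show "0 \<le> lead_val v x" if "x \<in> val_laurent v" "x \<noteq> 0" for x
    using that nth_fls_subdegree_nonzero[of x] unfolding val_laurent_def lead_val_def by blast
  show "\<exists>q\<in>val_laurent v. h = q \<or> lead_val v (h - q) < 0" for h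
  proof (cases "h \<in> val_laurent v")
    case False
    then obtain m where m: "\<not> ?V (h $$ m)" by (auto simp: val_laurent_def)
    let ?d = "fls_subdegree h"
    have ge: "?d \<le> m" if "\<not> ?V (h $$ m)" for m
      using that fls_subdegree_leI by blast
    \<comment> \<open>Coefficients below the subdegree vanish, so offsets from it are natural
      numbers and a first bad one exists.\<close>
    have "\<exists>k. \<not> ?V (h $$ (?d + int k))"
      using m ge[OF m] by (intro exI[of _ "nat (m - ?d)"]) simp
    then obtain k where k: "\<not> ?V (h $$ (?d + int k))" "\<And>j. j < k \<Longrightarrow> ?V (h $$ (?d + int j))"
      using exists_least_iff[of "\<lambda>k. \<not> ?V (h $$ (?d + int k))"] by blast
    let ?n = "?d + int k"
    have below: "?V (h $$ i)" if "i < ?n" for i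
      using ge[of i] k(2)[of "nat (i - ?d)"] that by (cases "?d \<le> i") auto
    define q where "q = Abs_fls (\<lambda>i. if i < ?n then h $$ i else 0)"
    have q: "q $$ i = (if i < ?n then h $$ i else 0)" for i
      unfolding q_def by (rule nth_Abs_fls_lower_bound[of ?d]) auto
    have "fls_subdegree (h - q) = ?n"
      using k(1) q by (intro fls_subdegree_eqI) auto
    then have "lead_val v (h - q) < 0" using k(1) q by (auto simp: lead_val_def)
    moreover have "q \<in> val_laurent v" using q below by (simp add: val_laurent_def)
    ultimately show ?thesis by blast
  qed blast
qed

definition fls_of :: "'a::idom fps \<Rightarrow> 'a fract fls" where
  "fls_of f = fps_to_fls (Abs_fps (\<lambda>n. to_fract (f $ n)))"

lemma fls_of_nth: "fls_of f $$ n = (if n < 0 then 0 else to_fract (f $ nat n))"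
  by (simp add: fls_of_def)

lemma to_fract_sum: "to_fract (sum f A) = (\<Sum>i\<in>A. to_fract (f i))"
  by (induction A rule: infinite_finite_induct) simp_all

lemma fls_of_add: "fls_of (f + g) = fls_of f + fls_of g"
  by (rule fls_eqI) (simp add: fls_of_nth)

lemma fls_of_mult: "fls_of (f * g) = fls_of f * fls_of g"
proof -
  have "Abs_fps (\<lambda>n. to_fract ((f * g) $ n)) = Abs_fps (\<lambda>n. to_fract (f $ n)) * Abs_fps (\<lambda>n. to_fract (g $ n))"
    by (rule fps_ext) (simp add: fps_mult_nth to_fract_sum)
  then show ?thesis by (simp add: fls_of_def fls_times_fps_to_fls)
qed

lemma fls_of_eq_0_iff [simp]: "fls_of f = 0 \<longleftrightarrow> f = 0"
  by (auto simp: fls_of_def fps_eq_iff)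

lemma fls_subdegree_fls_of: "f \<noteq> 0 \<Longrightarrow> fls_subdegree (fls_of f) = int (subdegree f)"
  by (rule fls_subdegree_eqI) (auto simp: fls_of_nth intro!: nth_less_subdegree_zero)

context
  fixes W :: "('a::idom fract \<Rightarrow> int) set"
  assumes W: "krull_valuations (dom_of TYPE('a)) W"
begin

interpretation W: krull_valuation_family "dom_of TYPE('a)" W
  by standard (rule domain_in_field_dom_of, rule W)

lemma euclidean_subring_W: "v \<in> W \<Longrightarrow> euclidean_subring (val_laurent v) (lead_val v)"
  by (rule euclidean_subring_val_laurent[OF W.val])

lemma fls_of_mem: "v \<in> W \<Longrightarrow> fls_of f \<in> val_laurent v"
proof -
  assume v: "v \<in> W"
  have "to_fract c = 0 \<or> 0 \<le> v (to_fract c)" for c :: 'a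
    using W.mem_iff v to_fract_in_dom_of by blast
  then show "fls_of f \<in> val_laurent v" by (simp add: val_laurent_def fls_of_nth)
qed

lemma fps_krull_valuations: "\<exists>W'. krull_valuations (dom_of TYPE('a fps)) W'"
proof -
  let ?irred = "\<lambda>v. euclidean_subring.irred (val_laurent v) (lead_val v)"
  let ?ord = "\<lambda>v p f. int (euclidean_subring.mult_order (val_laurent v) p (fls_of f))"
  let ?sub = "\<lambda>f::'a fps. int (subdegree f)"
  \<comment> \<open>\<open>X\<close> is a unit in every V((X)), so the orders at primes only detect
    divisibility up to powers of \<open>X\<close>; the \<open>X\<close>-order supplies the
    rest.\<close>
  define N where "N = insert ?sub {?ord v p | v p. v \<in> W \<and> ?irred v p}"
  have N_cases: "n = ?sub \<or> (\<exists>v p. v \<in> W \<and> ?irred v p \<and> n = ?ord v p)" if "n \<in> N" for n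
    using that by (auto simp: N_def)
  have "krull_valuations (dom_of TYPE('a fps)) (fract_val ` N)"
  proof (rule fract_krull_valuations)
    show "n (f * g) = n f + n g" if "n \<in> N" "f \<noteq> 0" "g \<noteq> 0" for n f g
      using N_cases[OF that(1)] that(2,3) euclidean_subring.mult_order_mult[OF euclidean_subring_W _ fls_of_mem _ fls_of_mem]
      by (auto simp: fls_of_mult)
    show "min (n f) (n g) \<le> n (f + g)" if n: "n \<in> N" and fg: "f \<noteq> 0" "g \<noteq> 0" "f + g \<noteq> 0" for n f g
      using N_cases[OF n]
    proof (elim disjE exE conjE)
      assume "n = ?sub"
      then show ?thesis using subdegree_add_ge'[of f g] fg(3) by auto
    next
      fix v p assume v: "v \<in> W" and p: "?irred v p" and n: "n = ?ord v p"
      have "fls_of f + fls_of g \<noteq> 0" using fg(3) by (simp flip: fls_of_add)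
      then show ?thesis
        using euclidean_subring.mult_order_add[OF euclidean_subring_W[OF v] p fls_of_mem[OF v] _ fls_of_mem[OF v], of f g] fg n
        by (simp add: fls_of_add min_def split: if_splits)
    qed
    show "0 \<le> n f" if "n \<in> N" for n f using N_cases[OF that] by auto
    show "finite {n \<in> N. n f \<noteq> 0}" if f: "f \<noteq> 0" for f
    proof -
      let ?c = "f $ subdegree f"
      let ?B = "{v \<in> W. v (to_fract ?c) \<noteq> 0}"
      let ?O = "\<lambda>v. {euclidean_subring.mult_order (val_laurent v) p | p.
        ?irred v p \<and> euclidean_subring.mult_order (val_laurent v) p (fls_of f) \<noteq> 0}"
      have fls0: "fls_of f \<noteq> 0" using f by simp
      have fin: "finite (?O v)" if "v \<in> W" for v
        using euclidean_subring.finite_mult_orders[OF euclidean_subring_W[OF that] fls_of_mem[OF that] fls0] .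
      have "{n \<in> N. n f \<noteq> 0} \<subseteq> insert ?sub (\<Union>v\<in>?B. (\<lambda>o' f. int (o' (fls_of f))) ` ?O v)"
      proof
        fix n assume n: "n \<in> {n \<in> N. n f \<noteq> 0}"
        then have "n = ?sub \<or> (\<exists>v p. v \<in> W \<and> ?irred v p \<and> n = ?ord v p)" using N_cases by blast
        then show "n \<in> insert ?sub (\<Union>v\<in>?B. (\<lambda>o' f. int (o' (fls_of f))) ` ?O v)"
        proof (elim disjE exE conjE)
          fix v p assume v: "v \<in> W" and p: "?irred v p" and eq: "n = ?ord v p"
          have nz: "euclidean_subring.mult_order (val_laurent v) p (fls_of f) \<noteq> 0" using n eq by simp
          \<comment> \<open>A positive order means that \<open>f\<close> is not a unit in V((X)), so
            \<open>v\<close> is nonzero on its lowest coefficient. Only finitely many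
            \<open>v\<close> qualify, each with finitely many orders.\<close>
          have "lead_val v (fls_of f) \<noteq> 0"
            using euclidean_subring.phi_div_less[OF euclidean_subring_W[OF v] p fls_of_mem[OF v] fls0]
              euclidean_subring.mult_order_pos_iff[OF euclidean_subring_W[OF v] p fls_of_mem[OF v] fls0] nz by auto
          then have "v \<in> ?B" using v f by (simp add: lead_val_def fls_subdegree_fls_of fls_of_nth)
          then show ?thesis using p nz eq by blast
        qed simp
      qed
      moreover have "finite ?B" using W.finite_nonzero[of "to_fract ?c"] f by simp
      ultimately show ?thesis using fin finite_subset by (auto intro: finite_subset)
    qed
    show "g dvd f" if f: "f \<noteq> 0" and g: "g \<noteq> 0" and le: "\<And>n. n \<in> N \<Longrightarrow> n g \<le> n f" for f g
    proof -
      define h where "h = fls_of f / fls_of g"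
      have fh: "fls_of f = fls_of g * h" using g by (simp add: h_def)
      then have h0: "h \<noteq> 0" using f by auto
      have h_V: "h \<in> val_laurent v" if v: "v \<in> W" for v
        unfolding h_def
      proof (rule euclidean_subring.divide_mem_if_mult_order_le[OF euclidean_subring_W[OF v] fls_of_mem[OF v] _ fls_of_mem[OF v]])
        fix p assume "?irred v p"
        then have "?ord v p \<in> N" using v by (auto simp: N_def)
        from le[OF this] show "euclidean_subring.mult_order (val_laurent v) p (fls_of g)
            \<le> euclidean_subring.mult_order (val_laurent v) p (fls_of f)" by simp
      qed (use f g in auto)
      have "subdegree g \<le> subdegree f" using le[of ?sub] by (simp add: N_def)
      moreover have "fls_subdegree (fls_of f) = fls_subdegree (fls_of g) + fls_subdegree h"
        unfolding fh using h0 g by simp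
      ultimately have deg: "fls_subdegree h \<ge> 0" using f g by (simp add: fls_subdegree_fls_of)
      \<comment> \<open>The quotient lies in V((X)) for every \<open>v \<in> W\<close>, so each
        coefficient lies in all the valuation rings and hence in D; \<open>deg\<close> excludes
        negative exponents.\<close>
      have "h $$ n \<in> dom_of TYPE('a)" for n
        using h_V unfolding W.mem_iff val_laurent_def by blast
      then have "\<forall>n. \<exists>c. h $$ n = to_fract c" by (simp add: dom_of_iff)
      then obtain c where c: "\<And>n. h $$ n = to_fract (c n)" by metis
      have "h = fls_of (Abs_fps (\<lambda>n. c (int n)))"
        using deg by (intro fls_eqI) (auto simp: fls_of_nth simp flip: c)
      then have "fls_of (f - g * Abs_fps (\<lambda>n. c (int n))) = 0"
        using fh fls_of_add[of "f - g * Abs_fps (\<lambda>n. c (int n))" "g * Abs_fps (\<lambda>n. c (int n))"]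
        by (simp add: fls_of_mult)
      then show ?thesis by simp
    qed
  qed
  then show ?thesis ..
qed

end

theorem corollary1p9:
  assumes "krull_like_PVMD (dom_of TYPE('a::idom))"
  shows "krull_like_PVMD (dom_of TYPE('a fps)) \<longleftrightarrow> krull_domain (dom_of TYPE('a))"
proof
  interpret fraction_domain "dom_of TYPE('a)" by standard (rule domain_in_field_dom_of)
  assume "krull_like_PVMD (dom_of TYPE('a fps))"
  then have "completely_integrally_closed (dom_of TYPE('a))"
    using assms by (intro completely_integrally_closed_if_fps_valuation)
      (auto simp: krull_like_PVMD_def strongly_discrete_valuation_domain_def)
  with assms show "krull_domain (dom_of TYPE('a))"
    by (rule krull_domain_if_completely_integrally_closed)
next
  assume "krull_domain (dom_of TYPE('a))"
  then obtain W where "krull_valuations (dom_of TYPE('a)) W"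
    using krull_domain_krull_valuations by blast
  then obtain W' where "krull_valuations (dom_of TYPE('a fps)) W'"
    using fps_krull_valuations by blast
  then interpret krull_valuation_family "dom_of TYPE('a fps)" W'
    by unfold_locales (rule domain_in_field_dom_of)
  show "krull_like_PVMD (dom_of TYPE('a fps))" by (rule krull_like_PVMD)
qed

end
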